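(* Let $n,m\ge1$ be integers, let $\rho$ be a $2^n\times2^n$ density matrix with eigenvalues $\lambda_1(\rho)\ge\lambda_2(\rho)\ge\dots\ge\lambda_{2^n}(\rho)$, and let $\hat\rho$ be the linear estimator of $\rho$ built from $m$ independent repetitions of each of the $3^n$ Pauli measurements. For $\nu>0$ let $$\hat\rho_\nu=\arg\min_R\left[\|R-\hat\rho\|_F^2+\nu\cdot\mathrm{rank}(R)\right],$$ where the minimum is over all $2^n\times2^n$ Hermitian matrices $R$. For any $\theta>0$ put $c(\theta)=1+2/\theta$, and for $\varepsilon\in(0,1)$ choose $$\nu=\nu(\theta,\varepsilon)=32(1+\theta)\left(\frac43\right)^n\frac{n\log(2)-\log(\varepsilon)}{m}.$$ Then $$\|\hat\rho_{\nu(\theta,\varepsilon)}-\rho\|_F^2\le\min_{k\in\{1,\dots,2^n\}}\left\{c^2(\theta)\sum_{j>k}\lambda_j^2(\rho)+2c(\theta)\,\nu(\theta,\varepsilon)\,k\right\}$$ with probability larger than $1-\varepsilon$.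
   Context: A $2^n\times 2^n$ density matrix is a complex Hermitian positive semidefinite matrix $\rho$ with $\mathrm{Tr}(\rho)=1$. Let $\sigma_x,\sigma_y,\sigma_z$ be the $2\times2$ Pauli matrices and $\sigma_I=I$ the $2\times 2$ identity. Put $\mathcal E^n=\{x,y,z\}^n$, $\mathcal R^n=\{-1,1\}^n$, $\mathcal M^n=\{I,x,y,z\}^n$. For $\mathbf b\in\mathcal M^n$ set $\sigma_{\mathbf b}=\sigma_{b_1}\otimes\cdots\otimes\sigma_{b_n}$, $E_{\mathbf b}=\{j: b_j=I\}$, and let $d(\mathbf b)$ be the cardinality of $E_{\mathbf b}$. For $a\in\{x,y,z\}$, $r\in\{-1,1\}$, $P^a_r$ is the orthogonal projector onto the eigenspace of $\sigma_a$ for the eigenvalue $r$; $P^{\mathbf a}_{\mathbf r}=P^{a_1}_{r_1}\otimes\cdots\otimes P^{a_n}_{r_n}$. Data: $R^{\mathbf a,i}$, $\mathbf a\in\mathcal E^n$, $1\le i\le m$, are independent random variables with values in $\mathcal R^n$ such that $\mathbb P(R^{\mathbf a,i}=\mathbf r)=\mathrm{Tr}(\rho\cdot P^{\mathbf a}_{\mathbf r})$ for all $\mathbf r\in\mathcal R^n$. Put $\hat p_{(\mathbf r,\mathbf a)}=\frac1m\sum_{i=1}^m\delta_{R^{\mathbf a,i},\mathbf r}$ ($\delta$ the Kronecker symbol). Let $P_{(\mathbf r,\mathbf a),\mathbf b}=\prod_{j\notin E_{\mathbf b}}r_j\,\mathbf I(a_j=b_j)$ ($\mathbf I$ the indicator,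 empty products equal $1$). The linear estimator is $$\hat\rho_{\mathbf b}=\frac1{3^{d(\mathbf b)}2^n}\sum_{(\mathbf r,\mathbf a)\in\mathcal R^n\times\mathcal E^n}\hat p_{(\mathbf r,\mathbf a)}P_{(\mathbf r,\mathbf a),\mathbf b},\qquad \hat\rho=\sum_{\mathbf b\in\mathcal M^n}\hat\rho_{\mathbf b}\sigma_{\mathbf b}.$$ $\|A\|_F^2=\mathrm{Tr}(A^\dagger A)$ is the squared Frobenius norm. $\hat\rho_\nu$ denotes any minimizer of the stated criterion. *)

theory Defs
  imports "HOL-Probability.Independent_Family" "Jordan_Normal_Form.Schur_Decomposition"
    "Jordan_Normal_Form.DL_Rank"
begin

definition mat_trace :: "complex mat \<Rightarrow> complex" where
  "mat_trace A = (\<Sum>i<dim_row A. A $$ (i, i))"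

definition frob_norm_sq :: "complex mat \<Rightarrow> real" where
  "frob_norm_sq A = Re (mat_trace (mat_adjoint A * A))"

definition hermitian_mat :: "nat \<Rightarrow> complex mat \<Rightarrow> bool" where
  "hermitian_mat N A \<longleftrightarrow> A \<in> carrier_mat N N \<and> mat_adjoint A = A"

definition density_matrix :: "nat \<Rightarrow> complex mat \<Rightarrow> bool" where
  "density_matrix N A \<longleftrightarrow> hermitian_mat N A
     \<and> (\<forall>v \<in> carrier_vec N. 0 \<le> Re ((A *\<^sub>v v) \<bullet>c v)) \<and> mat_trace A = 1"

text \<open>The eigenvalues of a matrix of size \<open>N\<close>, counted with algebraic multiplicity and listed in
  nonincreasing order as \<open>lam 1, \<dots>, lam N\<close>; this determines \<open>lam\<close> on \<open>{1..N}\<close>.\<close>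

definition ordered_eigenvalues :: "nat \<Rightarrow> complex mat \<Rightarrow> (nat \<Rightarrow> real) \<Rightarrow> bool" where
  "ordered_eigenvalues N A lam \<longleftrightarrow>
     char_poly A = (\<Prod>j=1..N. [:- complex_of_real (lam j), 1:])
     \<and> (\<forall>i j. 1 \<le> i \<longrightarrow> i \<le> j \<longrightarrow> j \<le> N \<longrightarrow> lam j \<le> lam i)"

text \<open>Kronecker product: the first factor carries the most significant part of the index.\<close>

definition kron :: "complex mat \<Rightarrow> complex mat \<Rightarrow> complex mat" where
  "kron A B = mat (dim_row A * dim_row B) (dim_col A * dim_col B)
     (\<lambda>(i, j). A $$ (i div dim_row B, j div dim_col B) * B $$ (i mod dim_row B, j mod dim_col B))"

definition kron_list :: "complex mat list \<Rightarrow> complex mat" where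
  "kron_list As = foldr kron As (1\<^sub>m 1)"

datatype pauli = PI | PX | PY | PZ

fun pauli_mat :: "pauli \<Rightarrow> complex mat" where
  "pauli_mat PI = 1\<^sub>m 2"
| "pauli_mat PX = mat_of_rows_list 2 [[0, 1], [1, 0]]"
| "pauli_mat PY = mat_of_rows_list 2 [[0, - \<i>], [\<i>, 0]]"
| "pauli_mat PZ = mat_of_rows_list 2 [[1, 0], [0, - 1]]"

text \<open>The index sets \<open>{x,y,z}\<^sup>n\<close>, \<open>{-1,1}\<^sup>n\<close> and \<open>{I,x,y,z}\<^sup>n\<close>, as lists of length \<open>n\<close>
  (positions \<open>0, \<dots>, n - 1\<close>).\<close>

definition settings :: "nat \<Rightarrow> pauli list set" where
  "settings n = {a. length a = n \<and> set a \<subseteq> {PX, PY, PZ}}"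

definition outcomes :: "nat \<Rightarrow> int list set" where
  "outcomes n = {r. length r = n \<and> set r \<subseteq> {-1, 1}}"

definition pauli_words :: "nat \<Rightarrow> pauli list set" where
  "pauli_words n = {b. length b = n}"

definition identity_positions :: "pauli list \<Rightarrow> nat set" where
  "identity_positions b = {j. j < length b \<and> b ! j = PI}"

definition pauli_tensor :: "pauli list \<Rightarrow> complex mat" where
  "pauli_tensor b = kron_list (map pauli_mat b)"

definition eigenspace :: "complex mat \<Rightarrow> complex \<Rightarrow> complex vec set" where
  "eigenspace A c = {v \<in> carrier_vec (dim_row A). A *\<^sub>v v = c \<cdot>\<^sub>v v}"

definition orth_projector_onto :: "nat \<Rightarrow> complex vec set \<Rightarrow> complex mat \<Rightarrow> bool" where
  "orth_projector_onto N V P \<longleftrightarrow>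
     hermitian_mat N P \<and> P * P = P \<and> (\<lambda>v. P *\<^sub>v v) ` carrier_vec N = V"

definition pauli_proj :: "pauli \<Rightarrow> int \<Rightarrow> complex mat" where
  "pauli_proj a r = (THE P. orth_projector_onto 2 (eigenspace (pauli_mat a) (of_int r)) P)"

text \<open>The description of \<open>pauli_proj\<close> is proper: for \<open>a \<noteq> I\<close> and \<open>r = \<plusminus>1\<close> it
  denotes the unique orthogonal projector onto the eigenspace.\<close>

lemma mat_adjoint_index:
  fixes A :: "complex mat"
  assumes "A \<in> carrier_mat N N" "i < N" "j < N"
  shows "mat_adjoint A $$ (i, j) = cnj (A $$ (j, i))"
  using assms by (simp add: mat_adjoint_def mat_of_rows_def)

lemma mat_adjoint_mult_adjoint:
  fixes A B :: "complex mat"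
  assumes "A \<in> carrier_mat N N" "B \<in> carrier_mat N N"
  shows "mat_adjoint (A * B) = mat_adjoint B * mat_adjoint A"
  using assms
  by (intro eq_matI) (auto simp: mat_adjoint_def mat_of_rows_def scalar_prod_def mult.commute
      intro!: sum.cong)

lemma orth_projector_onto_absorb:
  assumes P: "orth_projector_onto N V P" and Q: "orth_projector_onto N V Q"
  shows "P * Q = Q"
proof -
  have cP: "P \<in> carrier_mat N N" and cQ: "Q \<in> carrier_mat N N" and PP: "P * P = P"
    using P Q by (auto simp: orth_projector_onto_def hermitian_mat_def)
  have eq: "P *\<^sub>v (Q *\<^sub>v v) = Q *\<^sub>v v" if v: "v \<in> carrier_vec N" for v
  proof -
    have "Q *\<^sub>v v \<in> (\<lambda>v. P *\<^sub>v v) ` carrier_vec N"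
      using P Q v by (auto simp: orth_projector_onto_def)
    then obtain w where w: "w \<in> carrier_vec N" "Q *\<^sub>v v = P *\<^sub>v w" by auto
    have "P *\<^sub>v (P *\<^sub>v w) = (P * P) *\<^sub>v w"
      using assoc_mult_mat_vec[OF cP cP w(1)] by simp
    then show ?thesis using w PP by simp
  qed
  show ?thesis
  proof (rule eq_matI)
    fix i j assume ij: "i < dim_row Q" "j < dim_col Q"
    then have j: "j < N" and i: "i < N" using cQ by auto
    have "col (P * Q) j = P *\<^sub>v col Q j" using cP cQ j by (intro col_mult2) auto
    also have "col Q j = Q *\<^sub>v unit_vec N j"
      using cQ j by (intro eq_vecI) (auto simp: scalar_prod_right_unit)
    also have "P *\<^sub>v (Q *\<^sub>v unit_vec N j) = Q *\<^sub>v unit_vec N j" by (rule eq) simp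
    also have "\<dots> = col Q j"
      using cQ j by (intro eq_vecI) (auto simp: scalar_prod_right_unit)
    finally have "vec_index (col (P * Q) j) i = vec_index (col Q j) i" by simp
    then show "(P * Q) $$ (i, j) = Q $$ (i, j)" using cP cQ i j by simp
  qed (use cP cQ in auto)
qed

lemma orth_projector_onto_unique:
  assumes "orth_projector_onto N V P" "orth_projector_onto N V Q"
  shows "P = Q"
proof -
  have c: "P \<in> carrier_mat N N" "Q \<in> carrier_mat N N"
    and h: "mat_adjoint P = P" "mat_adjoint Q = Q"
    using assms by (auto simp: orth_projector_onto_def hermitian_mat_def)
  have "P = mat_adjoint (Q * P)"
    using orth_projector_onto_absorb[OF assms(2,1)] h by simp
  also have "\<dots> = P * Q" using mat_adjoint_mult_adjoint[OF c(2,1)] h by simp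
  also have "\<dots> = Q" by (rule orth_projector_onto_absorb[OF assms])
  finally show ?thesis .
qed

lemma orth_projector_onto_pauli:
  assumes a: "a \<in> {PX, PY, PZ}" and r: "r \<in> {-1, 1::int}"
  shows "orth_projector_onto 2 (eigenspace (pauli_mat a) (of_int r))
           ((1 / 2 :: complex) \<cdot>\<^sub>m (1\<^sub>m 2 + of_int r \<cdot>\<^sub>m pauli_mat a))" (is "orth_projector_onto 2 ?E ?P")
proof -
  have S: "pauli_mat a \<in> carrier_mat 2 2"
    using a by (auto simp: mat_of_rows_list_def)
  have SS: "pauli_mat a * pauli_mat a = 1\<^sub>m 2"
    using a by (auto intro!: eq_matI simp: mat_of_rows_list_def scalar_prod_def less_2_cases_iff less_Suc_eq)
  have rr: "complex_of_int r * complex_of_int r = 1" using r by auto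
  have P: "?P \<in> carrier_mat 2 2" using S by auto
  have adj: "mat_adjoint ?P = ?P"
  proof (rule eq_matI)
    fix i j assume "i < dim_row ?P" "j < dim_col ?P"
    then have ij: "i < 2" "j < 2" using P by auto
    show "mat_adjoint ?P $$ (i, j) = ?P $$ (i, j)"
      unfolding mat_adjoint_index[OF P ij]
      using ij a r by (auto simp: mat_of_rows_list_def less_2_cases_iff)
  qed (use S in \<open>auto simp: mat_adjoint_def\<close>)
  have PP: "?P * ?P = ?P"
    using a r by (auto intro!: eq_matI
        simp: mat_of_rows_list_def scalar_prod_def less_2_cases_iff less_Suc_eq)
  have app: "?P *\<^sub>v v = (1 / 2 :: complex) \<cdot>\<^sub>v (v + of_int r \<cdot>\<^sub>v (pauli_mat a *\<^sub>v v))"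
    if "v \<in> carrier_vec 2" for v
    using a r that by (auto intro!: eq_vecI
        simp: mat_of_rows_list_def scalar_prod_def numeral_2_eq_2 less_Suc_eq field_simps)
  have "(\<lambda>v. ?P *\<^sub>v v) ` carrier_vec 2 = ?E"
  proof (intro Set.equalityI subsetI)
    fix w assume "w \<in> (\<lambda>v. ?P *\<^sub>v v) ` carrier_vec 2"
    then obtain v where v: "v \<in> carrier_vec 2" "w = ?P *\<^sub>v v" by auto
    have "pauli_mat a * ?P = of_int r \<cdot>\<^sub>m ?P"
      using a r by (auto intro!: eq_matI
          simp: mat_of_rows_list_def scalar_prod_def less_2_cases_iff less_Suc_eq)
    then have "pauli_mat a *\<^sub>v w = (of_int r \<cdot>\<^sub>m ?P) *\<^sub>v v"
      using v assoc_mult_mat_vec[OF S P v(1)] by simp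
    also have "\<dots> = of_int r \<cdot>\<^sub>v w"
      unfolding v(2) using v(1) P by (intro eq_vecI) (auto simp del: index_smult_mat(1))
    finally show "w \<in> ?E"
      using v(2) S mult_mat_vec_carrier[OF P v(1)] by (simp add: eigenspace_def)
  next
    fix w assume "w \<in> ?E"
    then have w: "w \<in> carrier_vec 2" "pauli_mat a *\<^sub>v w = of_int r \<cdot>\<^sub>v w"
      using S by (auto simp: eigenspace_def)
    have "?P *\<^sub>v w = w"
      using w rr by (auto intro!: eq_vecI simp: app mult.assoc[symmetric])
    then show "w \<in> (\<lambda>v. ?P *\<^sub>v v) ` carrier_vec 2"
      using w(1) by (metis image_eqI)
  qed
  then show ?thesis
    using P PP adj by (auto simp: orth_projector_onto_def hermitian_mat_def)
qed

lemma pauli_proj_eq: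
  assumes "a \<in> {PX, PY, PZ}" and "r \<in> {-1, 1::int}"
  shows "pauli_proj a r = (1 / 2 :: complex) \<cdot>\<^sub>m (1\<^sub>m 2 + of_int r \<cdot>\<^sub>m pauli_mat a)"
  unfolding pauli_proj_def
  using orth_projector_onto_pauli[OF assms]
  by (rule the_equality) (rule orth_projector_onto_unique[OF _ orth_projector_onto_pauli[OF assms]])

definition outcome_proj :: "pauli list \<Rightarrow> int list \<Rightarrow> complex mat" where
  "outcome_proj a r = kron_list (map2 pauli_proj a r)"

text \<open>In what follows \<open>D a i\<close> is the observed outcome of the \<open>i\<close>-th repetition
  (\<open>1 \<le> i \<le> m\<close>) of the measurement in setting \<open>a\<close>.\<close>

definition emp_freq :: "nat \<Rightarrow> (pauli list \<Rightarrow> nat \<Rightarrow> int list) \<Rightarrow> int list \<Rightarrow> pauli list \<Rightarrow> real" where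
  "emp_freq m D r a = (1 / real m) * (\<Sum>i=1..m. of_bool (D a i = r))"

definition design_coeff :: "int list \<Rightarrow> pauli list \<Rightarrow> pauli list \<Rightarrow> real" where
  "design_coeff r a b =
     (\<Prod>j\<in>{..<length b} - identity_positions b. real_of_int (r ! j) * of_bool (a ! j = b ! j))"

definition lin_est_coeff ::
    "nat \<Rightarrow> nat \<Rightarrow> (pauli list \<Rightarrow> nat \<Rightarrow> int list) \<Rightarrow> pauli list \<Rightarrow> real" where
  "lin_est_coeff n m D b = 1 / (3 ^ card (identity_positions b) * 2 ^ n) *
     (\<Sum>(r, a) \<in> outcomes n \<times> settings n. emp_freq m D r a * design_coeff r a b)"

text \<open>The matrix sum is written entrywise.\<close>

definition lin_estimator ::
    "nat \<Rightarrow> nat \<Rightarrow> (pauli list \<Rightarrow> nat \<Rightarrow> int list) \<Rightarrow> complex mat" where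
  "lin_estimator n m D = mat (2 ^ n) (2 ^ n) (\<lambda>(k, l).
     \<Sum>b\<in>pauli_words n. complex_of_real (lin_est_coeff n m D b) * pauli_tensor b $$ (k, l))"

definition rank_criterion :: "nat \<Rightarrow> real \<Rightarrow> complex mat \<Rightarrow> complex mat \<Rightarrow> real" where
  "rank_criterion N \<nu> A R = frob_norm_sq (R - A) + \<nu> * real (vec_space.rank N R)"

text \<open>\<open>S\<close> is a value of \<open>argmin\<^sub>R\<close> of the criterion over Hermitian \<open>R\<close>.\<close>

definition rank_penalized_minimizer :: "nat \<Rightarrow> real \<Rightarrow> complex mat \<Rightarrow> complex mat \<Rightarrow> bool" where
  "rank_penalized_minimizer N \<nu> A S \<longleftrightarrow> is_arg_min (rank_criterion N \<nu> A) (hermitian_mat N) S"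

definition oracle_const :: "real \<Rightarrow> real" where
  "oracle_const \<theta> = 1 + 2 / \<theta>"

definition nu_choice :: "nat \<Rightarrow> nat \<Rightarrow> real \<Rightarrow> real \<Rightarrow> real" where
  "nu_choice n m \<theta> \<epsilon> = 32 * (1 + \<theta>) * (4 / 3) ^ n * ((real n * ln 2 - ln \<epsilon>) / real m)"

end

theory Submission
  imports Defs
begin

text \<open>
  Two independent facts combine: a deterministic inequality for the penalized minimizer, valid
  as soon as the operator norm of the error \<open>\<rho>\<close>-hat \<open>- \<rho>\<close> is at most the square root of
  \<open>\<tau> = \<nu> / (1 + \<theta>)\<close>, and a tail bound saying that this happens with probability
  larger than \<open>1 - \<epsilon>\<close>.

  The deterministic part (\<open>oracle_inequality\<close>) compares the minimizer \<open>S\<close> with the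
  truncation \<open>R\<close> of \<open>\<rho>\<close> to its first \<open>k\<close> eigenvalues. Minimality leaves the cross term
  \<open>2 tr ((S - R) E)\<close>, with \<open>E\<close> the estimation error. In the eigenbases of \<open>S - R\<close>
  and \<open>E\<close> this is a sum over the nonzero eigenvalues of \<open>S - R\<close>, of which there are at most
  \<open>rank S + k\<close>; Young's inequality splits it into a rank term, which the penalty absorbs, and
  a Frobenius term, which the left-hand side absorbs.

  For the tail bound, the estimator is the sum over the settings, averaged over the repetitions, of
  independent matrices, one for each measurement: an outcome \<open>r\<close> in setting \<open>a\<close> contributes the tensor product of the matrices
  \<open>(1/3 + r\<^sub>j \<sigma>\<^bsub>a\<^sub>j\<^esub>) / 2\<close> (\<open>snapshot\<close>). Each factor has eigenvalues \<open>2/3\<close>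
  and \<open>-1/3\<close>, so a snapshot has operator norm at most \<open>(2/3)^n\<close>. On one qubit, the sum over
  settings and outcomes of projector tensor snapshot is the swap operator, which says that the
  estimator is unbiased (\<open>snapshot_unbiased\<close>).

  Concentration is obtained from a single even moment (\<open>moment_bound\<close>): for a sum \<open>Y\<close> of
  independent centered Hermitian matrices \<open>X\<^sub>i\<close> with squared norms at most \<open>C\<close>, the expectation
  of \<open>tr Y^(2s)\<close> is at most \<open>N (2s - 1)!! (|I| C)^s\<close>. To see this, write
  \<open>tr Y^(2s+2)\<close> as the sum of the \<open>tr (X\<^sub>i Y^(2s+1))\<close> and subtract from each the
  same expression with \<open>Z = Y - X\<^sub>i\<close> instead of \<open>Y\<close>, whose expectation is zero. The
  difference telescopes into traces \<open>tr (X\<^sub>i Y^q X\<^sub>i Z^(2s-q))\<close>, and a two-variable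
  inequality for real numbers, transferred by the spectral theorem, bounds their sum over
  \<open>q\<close> by \<open>2s + 1\<close> times the mean of the two end terms. Markov's inequality, with \<open>s\<close> the
  least integer that is at least \<open>L = n ln 2 - ln \<epsilon>\<close>, then beats \<open>\<epsilon>\<close>, since \<open>\<tau>\<close>
  equals \<open>8 |I| C L\<close>.
\<close>

section \<open>Unitary diagonalization of Hermitian matrices\<close>

lemma mat_adjoint_carrier [simp]:
  "A \<in> carrier_mat n m \<Longrightarrow> mat_adjoint (A :: complex mat) \<in> carrier_mat m n"
  by (auto simp: mat_adjoint_def mat_of_rows_def)

lemma mat_adjoint_dim [simp]:
  "dim_row (mat_adjoint (A :: complex mat)) = dim_col A" "dim_col (mat_adjoint A) = dim_row A"
  by (auto simp: mat_adjoint_def mat_of_rows_def)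

lemma mat_adjoint_entry [simp]:
  "i < dim_col A \<Longrightarrow> j < dim_row A \<Longrightarrow> mat_adjoint (A :: complex mat) $$ (i, j) = cnj (A $$ (j, i))"
  by (simp add: mat_adjoint_def mat_of_rows_def)

lemma mat_adjoint_adjoint [simp]: "mat_adjoint (mat_adjoint A) = (A :: complex mat)"
  by (intro eq_matI) auto

lemma hermitian_entry:
  assumes "hermitian_mat N A" "k < N" "l < N"
  shows "A $$ (l, k) = cnj (A $$ (k, l))"
  using assms mat_adjoint_entry[of l A k] by (auto simp: hermitian_mat_def)

lemma mat_times_entry:
  assumes "A \<in> carrier_mat n m" "B \<in> carrier_mat m k" "i < n" "j < k"
  shows "(A * B) $$ (i, j) = (\<Sum>l<m. A $$ (i, l) * B $$ (l, j))"
  using assms by (simp add: scalar_prod_def lessThan_atLeast0)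

lemma adjoint_times_entry:
  fixes A :: "complex mat"
  assumes "A \<in> carrier_mat n m" "B \<in> carrier_mat n k" "i < m" "j < k"
  shows "(mat_adjoint A * B) $$ (i, j) = (\<Sum>l<n. cnj (A $$ (l, i)) * B $$ (l, j))"
  unfolding mat_times_entry[OF mat_adjoint_carrier[OF assms(1)] assms(2-4)]
  using assms by (intro sum.cong) auto

text \<open>Gram-Schmidt applied to a basis that begins with \<open>v\<close> keeps \<open>v\<close> in first place; only
  the lengths of the resulting vectors have to be corrected.\<close>

lemma unitary_with_first_column:
  fixes v :: "complex vec"
  assumes v: "v \<in> carrier_vec (Suc n)" and v0: "v \<noteq> 0\<^sub>v (Suc n)"
  shows "\<exists>U \<in> carrier_mat (Suc n) (Suc n). mat_adjoint U * U = 1\<^sub>m (Suc n) \<and> (\<exists>c. col U 0 = c \<cdot>\<^sub>v v)"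
proof -
  let ?N = "Suc n"
  interpret cof_vec_space ?N "TYPE(complex)" .
  define b where "b = basis_completion v"
  define ws where "ws = gram_schmidt ?N b"
  from basis_completion[OF v v0, folded b_def]
  have b: "set b \<subseteq> carrier_vec ?N" "distinct b" "\<not> lin_dep (set b)" "hd b = v" "length b = ?N"
    by auto
  then obtain vs where bv: "b = v # vs" by (cases b) auto
  from gram_schmidt_result[OF b(1,2,3) refl, folded ws_def]
  have ws: "set ws \<subseteq> carrier_vec ?N" "corthogonal ws" "length ws = ?N"
    by (auto simp: b(5))
  have hd_ws: "ws ! 0 = v"
    using gram_schmidt_hd[OF v, of vs, folded bv, folded ws_def] ws(3) by (cases ws) auto
  have wsi: "ws ! i \<in> carrier_vec ?N" if "i < ?N" for i using ws that by auto
  define q where "q i = (\<Sum>l<?N. (cmod (vec_index (ws ! i) l))\<^sup>2)" for i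
  have sp: "ws ! i \<bullet>c ws ! j = (\<Sum>l<?N. vec_index (ws ! i) l * cnj (vec_index (ws ! j) l))"
    if "i < ?N" "j < ?N" for i j
    using wsi[OF that(2)] by (auto simp: scalar_prod_def lessThan_atLeast0 intro!: sum.cong)
  have sp_self: "ws ! i \<bullet>c ws ! i = complex_of_real (q i)" if "i < ?N" for i
    unfolding sp[OF that that] q_def by (simp add: complex_mult_cnj cmod_def)
  have qpos: "q i > 0" if "i < ?N" for i
  proof -
    have "q i \<noteq> 0" using sp_self[OF that] corthogonalD[OF ws(2), of i i] ws(3) that by auto
    moreover have "q i \<ge> 0" unfolding q_def by (intro sum_nonneg) auto
    ultimately show ?thesis by linarith
  qed
  define U where "U = mat ?N ?N (\<lambda>(l, j). vec_index (ws ! j) l / complex_of_real (sqrt (q j)))"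
  have U: "U \<in> carrier_mat ?N ?N" by (simp add: U_def)
  have "mat_adjoint U * U = 1\<^sub>m ?N"
  proof (rule eq_matI)
    fix i j assume "i < dim_row (1\<^sub>m ?N)" "j < dim_col (1\<^sub>m ?N)"
    then have ij: "i < ?N" "j < ?N" by auto
    have "(mat_adjoint U * U) $$ (i, j) = (\<Sum>l<?N. cnj (U $$ (l, i)) * U $$ (l, j))"
      by (rule adjoint_times_entry[OF U U ij])
    also have "\<dots> = (ws ! j \<bullet>c ws ! i) / (complex_of_real (sqrt (q i)) * complex_of_real (sqrt (q j)))"
      unfolding sp[OF ij(2,1)] sum_divide_distrib using ij
      by (intro sum.cong) (auto simp: U_def)
    also have "\<dots> = (1\<^sub>m ?N) $$ (i, j)"
    proof (cases "i = j")
      case True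
      have "complex_of_real (sqrt (q j)) * complex_of_real (sqrt (q j)) = complex_of_real (q j)"
        using qpos[OF ij(2)] by (metis less_eq_real_def of_real_mult real_sqrt_mult_self abs_of_nonneg)
      then show ?thesis using True sp_self[OF ij(2)] qpos[OF ij(2)] ij by simp
    next
      case False
      then show ?thesis using corthogonalD[OF ws(2), of j i] ws(3) ij by simp
    qed
    finally show "(mat_adjoint U * U) $$ (i, j) = (1\<^sub>m ?N) $$ (i, j)" .
  qed (use U in auto)
  moreover have "col U 0 = (1 / complex_of_real (sqrt (q 0))) \<cdot>\<^sub>v v"
    using v by (intro eq_vecI) (auto simp: U_def hd_ws)
  ultimately show ?thesis using U by blast
qed

text \<open>Deflation along the prescribed list of roots: in an orthonormal basis that begins with an
  eigenvector for the first root, Hermitian symmetry clears the first row together with the first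
  column, and the remaining block is Hermitian with the remaining roots. The eigenvalues come in
  the order of the list, so that the decreasing order of the spectrum of \<open>\<rho>\<close> survives to the
  place where \<open>\<rho>\<close> is truncated.\<close>

theorem hermitian_spectral:
  assumes "hermitian_mat N A" and "char_poly A = (\<Prod>e\<leftarrow>es. [:- e, 1:])"
  shows "\<exists>U \<in> carrier_mat N N. mat_adjoint U * U = 1\<^sub>m N
           \<and> A = U * mat_diag N (\<lambda>i. es ! i) * mat_adjoint U"
  using assms
proof (induct es arbitrary: N A)
  case Nil
  then have A: "A \<in> carrier_mat N N" by (auto simp: hermitian_mat_def)
  have "N = 0" using degree_monic_char_poly[OF A] Nil by auto
  then show ?case using A by (intro bexI[of _ "1\<^sub>m N"]) auto
next
  case (Cons e es N A)
  from Cons(2) have A: "A \<in> carrier_mat N N" and hA: "mat_adjoint A = A"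
    by (auto simp: hermitian_mat_def)
  let ?cp = "char_poly A"
  from Cons(3) have cp: "?cp = [:- e, 1:] * (\<Prod>e\<leftarrow>es. [:- e, 1:])" by auto
  have mon: "monic (\<Prod>e\<leftarrow>es. [:- e, 1:])" by (rule monic_prod_list) auto
  have "degree ?cp = Suc (degree (\<Prod>e\<leftarrow>es. [:- e, 1:]))" unfolding cp
    by (subst degree_mult_eq) (use mon in auto)
  with degree_monic_char_poly[OF A] obtain n where N: "N = Suc n" by (cases N) auto
  have "eigenvalue A e" unfolding eigenvalue_root_char_poly[OF A] cp by simp
  then obtain v where "eigenvector A v e" unfolding eigenvalue_def by auto
  then have v: "v \<in> carrier_vec (Suc n)" "v \<noteq> 0\<^sub>v (Suc n)" and ev: "A *\<^sub>v v = e \<cdot>\<^sub>v v"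
    using A N by (auto simp: eigenvector_def)
  obtain W c where W: "W \<in> carrier_mat N N" and WW: "mat_adjoint W * W = 1\<^sub>m N"
    and W0: "col W 0 = c \<cdot>\<^sub>v v"
    using unitary_with_first_column[OF v] N by auto
  let ?W = "mat_adjoint W"
  have W': "?W \<in> carrier_mat N N" using W by simp
  have WW': "W * ?W = 1\<^sub>m N" using mat_mult_left_right_inverse[OF W' W WW] .
  define B where "B = ?W * A * W"
  have B: "B \<in> carrier_mat N N" using W W' A by (simp add: B_def mult_carrier_mat[of _ N N _ N])
  have hB: "mat_adjoint B = B"
    unfolding B_def using W W' A hA
    by (simp add: mat_adjoint_mult_adjoint[of _ N] assoc_mult_mat[of _ N N _ N _ N] mult_carrier_mat[of _ N N _ N])
  have AB: "A = W * B * ?W"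
  proof -
    have "W * B * ?W = (W * ?W) * A * (W * ?W)"
      unfolding B_def using W W' A by (simp add: assoc_mult_mat[of _ N N _ N _ N] mult_carrier_mat[of _ N N _ N])
    then show ?thesis using A WW' by simp
  qed
  have cW: "col W 0 \<in> carrier_vec N" using W by (intro carrier_vecI) simp
  have A0: "A *\<^sub>v col W 0 = e \<cdot>\<^sub>v col W 0"
    unfolding W0 using ev v A N
    by (simp add: mult_mat_vec[of _ N N] smult_smult_assoc mult.commute)
  have col0: "B $$ (i, 0) = (if i = 0 then e else 0)" if i: "i < N" for i
  proof -
    have "col B 0 = ?W *\<^sub>v (A *\<^sub>v col W 0)"
      unfolding B_def using W W' A N
      by (simp del: col_mult add: col_mult2[of _ N N _ N] assoc_mult_mat[of _ N N _ N _ N] mult_carrier_mat[of _ N N _ N])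
    also have "\<dots> = e \<cdot>\<^sub>v (?W *\<^sub>v col W 0)"
      unfolding A0 by (rule mult_mat_vec[OF W' cW])
    also have "?W *\<^sub>v col W 0 = col (?W * W) 0"
      using W W' N by (simp del: col_mult add: col_mult2[of _ N N _ N])
    finally have "vec_index (col B 0) i = vec_index (e \<cdot>\<^sub>v col (1\<^sub>m N) 0) i" unfolding WW by simp
    then show ?thesis using B i N by (auto split: if_splits)
  qed
  have row0: "B $$ (0, j) = 0" if j: "j < N" "j \<noteq> 0" for j
  proof -
    have "B $$ (0, j) = mat_adjoint B $$ (0, j)" using hB by simp
    also have "\<dots> = cnj (B $$ (j, 0))" using B j N by (intro mat_adjoint_entry) auto
    finally show ?thesis using col0[OF j(1)] j by simp
  qed
  define B1 where "B1 = mat 1 1 (\<lambda>_. e)"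
  define B3 where "B3 = mat n n (\<lambda>(i, j). B $$ (Suc i, Suc j))"
  have B1: "B1 \<in> carrier_mat 1 1" and B3: "B3 \<in> carrier_mat n n" by (auto simp: B1_def B3_def)
  have Bblock: "B = four_block_mat B1 (0\<^sub>m 1 n) (0\<^sub>m n 1) B3"
    using B col0 row0 N by (intro eq_matI) (auto simp: B1_def B3_def)
  have "mat_adjoint B3 = B3"
  proof (rule eq_matI)
    fix i j assume "i < dim_row B3" "j < dim_col B3"
    then have ij: "i < n" "j < n" using B3 by auto
    have "B $$ (Suc i, Suc j) = mat_adjoint B $$ (Suc i, Suc j)" using hB by simp
    also have "\<dots> = cnj (B $$ (Suc j, Suc i))" using B ij N by (intro mat_adjoint_entry) auto
    finally show "mat_adjoint B3 $$ (i, j) = B3 $$ (i, j)" using ij by (simp add: B3_def)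
  qed (use B3 in auto)
  then have h3: "hermitian_mat n B3" using B3 by (simp add: hermitian_mat_def)
  have "similar_mat B A"
    unfolding similar_mat_def
    by (intro exI, rule similar_mat_witI[of ?W W N]) (use W W' WW WW' A B B_def in auto)
  then have "char_poly B = ?cp" by (rule char_poly_similar)
  moreover have "char_poly B = char_poly B1 * char_poly B3"
    unfolding Bblock by (rule char_poly_four_block_zeros_col[OF B1 _ B3]) simp
  moreover have "char_poly B1 = [:- e, 1:]"
    by (simp add: B1_def char_poly_defs det_def sign_def)
  ultimately have "char_poly B3 = (\<Prod>e\<leftarrow>es. [:- e, 1:])"
    using cp by (metis mult_cancel_left pCons_eq_0_iff zero_neq_one)
  from Cons(1)[OF h3 this] obtain V where V: "V \<in> carrier_mat n n"
    and VV: "mat_adjoint V * V = 1\<^sub>m n" and BV: "B3 = V * mat_diag n (\<lambda>i. es ! i) * mat_adjoint V"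
    by auto
  let ?D = "mat_diag n (\<lambda>i. es ! i)"
  let ?V = "four_block_mat (1\<^sub>m 1) (0\<^sub>m 1 n) (0\<^sub>m n 1) V"
  have cV: "?V \<in> carrier_mat N N" using V N by auto
  have aV: "mat_adjoint ?V = four_block_mat (1\<^sub>m 1) (0\<^sub>m 1 n) (0\<^sub>m n 1) (mat_adjoint V)"
    using V by (intro eq_matI) auto
  have VV': "mat_adjoint ?V * ?V = 1\<^sub>m N"
  proof -
    have "mat_adjoint ?V * ?V = four_block_mat (1\<^sub>m 1) (0\<^sub>m 1 n) (0\<^sub>m n 1) (1\<^sub>m n)"
      unfolding aV using V VV by (subst mult_four_block_mat[of _ 1 1 _ n _ n _ _ 1 _ n]) auto
    also have "\<dots> = 1\<^sub>m N" unfolding N by (intro eq_matI) auto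
    finally show ?thesis .
  qed
  have D: "mat_diag N (\<lambda>i. (e # es) ! i) = four_block_mat B1 (0\<^sub>m 1 n) (0\<^sub>m n 1) ?D"
    using N by (intro eq_matI) (auto simp: mat_diag_def B1_def nth_Cons')
  have diag: "?V * mat_diag N (\<lambda>i. (e # es) ! i) * mat_adjoint ?V = B"
  proof -
    have cD: "?D \<in> carrier_mat n n" by (simp add: mat_diag_def)
    have cVD: "V * ?D \<in> carrier_mat n n" and cVDV: "V * ?D * mat_adjoint V \<in> carrier_mat n n"
      using V by (auto intro!: mult_carrier_mat)
    have "?V * mat_diag N (\<lambda>i. (e # es) ! i) = four_block_mat B1 (0\<^sub>m 1 n) (0\<^sub>m n 1) (V * ?D)"
      unfolding D using V B1 cD
      by (subst mult_four_block_mat[of _ 1 1 _ n _ n _ _ 1 _ n]) (auto simp: left_mult_zero_mat[OF cD])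
    also have "\<dots> * mat_adjoint ?V = four_block_mat B1 (0\<^sub>m 1 n) (0\<^sub>m n 1) (V * ?D * mat_adjoint V)"
      unfolding aV using V B1 cVD cVDV
      by (subst mult_four_block_mat[of _ 1 1 _ n _ n _ _ 1 _ n])
        (auto simp: right_mult_zero_mat[OF cVD] left_add_zero_mat[OF cVDV] simp del: mat_diag_dim)
    finally show ?thesis using BV Bblock by simp
  qed
  define Q where "Q = ?V"
  have Q: "Q \<in> carrier_mat N N" and QQ: "mat_adjoint Q * Q = 1\<^sub>m N"
    and BQ: "Q * mat_diag N (\<lambda>i. (e # es) ! i) * mat_adjoint Q = B"
    unfolding Q_def using cV VV' diag by auto
  have "A = W * Q * mat_diag N (\<lambda>i. (e # es) ! i) * mat_adjoint (W * Q)"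
    unfolding AB BQ[symmetric] using W W' Q
    by (simp add: mat_adjoint_mult_adjoint[of _ N] assoc_mult_mat[of _ N N _ N _ N] mult_carrier_mat[of _ N N _ N] mat_diag_def)
  moreover have "mat_adjoint (W * Q) * (W * Q) = 1\<^sub>m N"
  proof -
    have "mat_adjoint (W * Q) * (W * Q) = mat_adjoint Q * ((?W * W) * Q)"
      using W W' Q by (simp add: mat_adjoint_mult_adjoint[of _ N] assoc_mult_mat[of _ N N _ N _ N] mult_carrier_mat[of _ N N _ N])
    then show ?thesis using WW QQ Q by simp
  qed
  ultimately show ?case using W Q by (intro bexI[of _ "W * Q"]) auto
qed

section \<open>Traces of alternating products of Hermitian matrices\<close>

definition eigendecomp :: "nat \<Rightarrow> complex mat \<Rightarrow> (nat \<Rightarrow> real) \<Rightarrow> complex mat \<Rightarrow> bool" where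
  "eigendecomp N U d A \<longleftrightarrow> U \<in> carrier_mat N N \<and> mat_adjoint U * U = 1\<^sub>m N
     \<and> A = U * mat_diag N (\<lambda>i. complex_of_real (d i)) * mat_adjoint U"

lemma eigendecompD:
  assumes "eigendecomp N U d A"
  shows "U \<in> carrier_mat N N" "mat_adjoint U * U = 1\<^sub>m N" "U * mat_adjoint U = 1\<^sub>m N"
    "A = U * mat_diag N (\<lambda>i. complex_of_real (d i)) * mat_adjoint U"
proof -
  show *: "U \<in> carrier_mat N N" "mat_adjoint U * U = 1\<^sub>m N"
    "A = U * mat_diag N (\<lambda>i. complex_of_real (d i)) * mat_adjoint U"
    using assms by (auto simp: eigendecomp_def)
  show "U * mat_adjoint U = 1\<^sub>m N"
    by (rule mat_mult_left_right_inverse[OF _ *(1) *(2)]) (use *(1) in auto)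
qed

lemma mat_diag_cong: "(\<And>i. i < N \<Longrightarrow> f i = g i) \<Longrightarrow> mat_diag N f = mat_diag N g"
  by (intro eq_matI) (auto simp: mat_diag_def)

text \<open>The diagonal factor equals \<open>U\<^sup>* A U\<close>, which is Hermitian, so its entries are real.\<close>

lemma hermitian_eigendecomp_of_roots:
  assumes A: "hermitian_mat N A" and cp: "char_poly A = (\<Prod>e\<leftarrow>es. [:- e, 1:])"
  shows "\<exists>U. eigendecomp N U (\<lambda>i. Re (es ! i)) A"
proof -
  from hermitian_spectral[OF A cp] obtain U where U: "U \<in> carrier_mat N N"
    and UU: "mat_adjoint U * U = 1\<^sub>m N" and AU: "A = U * mat_diag N (\<lambda>i. es ! i) * mat_adjoint U"
    by auto
  let ?D = "mat_diag N (\<lambda>i. es ! i)"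
  have cA: "A \<in> carrier_mat N N" and hA: "mat_adjoint A = A" using A by (auto simp: hermitian_mat_def)
  have D: "?D = mat_adjoint U * A * U"
  proof -
    have "mat_adjoint U * A * U = (mat_adjoint U * U) * ?D * (mat_adjoint U * U)"
      unfolding AU using U by (simp add: assoc_mult_mat[of _ N N _ N _ N] mult_carrier_mat[of _ N N _ N])
    then show ?thesis unfolding UU by (simp add: left_mult_one_mat[of _ N N] right_mult_one_mat[of _ N N])
  qed
  have "mat_adjoint ?D = ?D"
    unfolding D using U cA hA
    by (simp add: mat_adjoint_mult_adjoint[of _ N] assoc_mult_mat[of _ N N _ N _ N] mult_carrier_mat[of _ N N _ N])
  then have "cnj (es ! i) = es ! i" if "i < N" for i
    using that mat_adjoint_entry[of i ?D i] by (simp add: mat_diag_def)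
  then have "complex_of_real (Re (es ! i)) = es ! i" if "i < N" for i
    using that by (simp add: complex_eq_iff)
  then have "?D = mat_diag N (\<lambda>i. complex_of_real (Re (es ! i)))"
    by (intro mat_diag_cong) simp
  then show ?thesis using U UU AU by (auto simp: eigendecomp_def)
qed

lemma hermitian_eigendecomp:
  assumes "hermitian_mat N A"
  shows "\<exists>U d. eigendecomp N U d A"
proof -
  have "A \<in> carrier_mat N N" using assms by (auto simp: hermitian_mat_def)
  then obtain es where "char_poly A = (\<Prod>e\<leftarrow>es. [:- e, 1:])" using char_poly_factorized by blast
  then show ?thesis using hermitian_eigendecomp_of_roots[OF assms] by blast
qed

lemma pow_mat_carrier [simp]: "A \<in> carrier_mat N N \<Longrightarrow> A ^\<^sub>m k \<in> carrier_mat N N"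
  using pow_mat_dim_square[of A N k] by auto

lemma eigendecomp_pow:
  assumes "eigendecomp N U d A"
  shows "A ^\<^sub>m k = U * mat_diag N (\<lambda>i. complex_of_real (d i ^ k)) * mat_adjoint U"
proof (induction k)
  case 0
  then show ?case using eigendecompD[OF assms] by auto
next
  case (Suc k)
  note U = eigendecompD[OF assms]
  have "A ^\<^sub>m Suc k = U * mat_diag N (\<lambda>i. complex_of_real (d i ^ k)) * ((mat_adjoint U * U)
      * (mat_diag N (\<lambda>i. complex_of_real (d i)) * mat_adjoint U))"
    unfolding pow_mat.simps Suc using U(1)
    by (subst U(4)) (simp add: assoc_mult_mat[of _ N N _ N _ N] mult_carrier_mat[of _ N N _ N])
  also have "\<dots> = U * (mat_diag N (\<lambda>i. complex_of_real (d i ^ k)) * mat_diag N (\<lambda>i. complex_of_real (d i)))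
      * mat_adjoint U"
    unfolding U(2) using U(1)
    by (simp add: assoc_mult_mat[of _ N N _ N _ N] mult_carrier_mat[of _ N N _ N] left_mult_one_mat[of _ N N]
        del: mat_diag_diag)
  finally show ?case by (simp add: mult.commute)
qed

lemma mat_trace_carrier: "A \<in> carrier_mat N M \<Longrightarrow> mat_trace A = (\<Sum>i<N. A $$ (i, i))"
  by (auto simp: mat_trace_def)

lemma mat_trace_times:
  assumes "A \<in> carrier_mat N N" "B \<in> carrier_mat N N"
  shows "mat_trace (A * B) = (\<Sum>k<N. \<Sum>l<N. A $$ (k, l) * B $$ (l, k))"
  using assms by (subst mat_trace_carrier[of _ N N])
    (auto intro!: sum.cong simp: mat_times_entry[OF assms] simp del: index_mult_mat(1))

lemma mat_trace_commute:
  assumes "A \<in> carrier_mat N N" "B \<in> carrier_mat N N"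
  shows "mat_trace (A * B) = mat_trace (B * A)"
  unfolding mat_trace_times[OF assms] mat_trace_times[OF assms(2,1)]
  by (subst sum.swap) (simp add: mult.commute)

lemma mat_trace_add:
  assumes "A \<in> carrier_mat N N" "B \<in> carrier_mat N N"
  shows "mat_trace (A + B) = mat_trace A + mat_trace B"
  using assms by (simp add: mat_trace_carrier[of _ N N] sum.distrib)

text \<open>Expanding in the eigenbases of both matrices gives weights that are nonnegative and independent
  of the exponents. Hence a polynomial inequality in two real variables turns into an inequality
  between traces of alternating products, although the two matrices need not commute.\<close>

lemma trace_spectral:
  assumes B: "eigendecomp N V b B" and A: "eigendecomp N U a A" and Z: "Z \<in> carrier_mat N N"
  shows "mat_trace (mat_adjoint Z * (B ^\<^sub>m k * (Z * A ^\<^sub>m l))) =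
    complex_of_real (\<Sum>i<N. \<Sum>j<N. (cmod ((mat_adjoint V * (Z * U)) $$ (i, j)))\<^sup>2 * (b i ^ k * a j ^ l))"
proof -
  note V = eigendecompD[OF B] and U = eigendecompD[OF A]
  let ?b = "mat_diag N (\<lambda>i. complex_of_real (b i ^ k))"
  let ?a = "mat_diag N (\<lambda>i. complex_of_real (a i ^ l))"
  define G where "G = mat_adjoint V * (Z * U)"
  have G: "G \<in> carrier_mat N N" using V(1) U(1) Z by (simp add: G_def mult_carrier_mat[of _ N N _ N])
  note ac = assoc_mult_mat[of _ N N _ N _ N] mult_carrier_mat[of _ N N _ N]
  have "mat_trace (mat_adjoint Z * (B ^\<^sub>m k * (Z * A ^\<^sub>m l)))
     = mat_trace ((mat_adjoint Z * (V * (?b * (G * ?a)))) * mat_adjoint U)"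
    unfolding eigendecomp_pow[OF B] eigendecomp_pow[OF A] G_def using V(1) U(1) Z by (simp add: ac)
  also have "\<dots> = mat_trace (mat_adjoint U * (mat_adjoint Z * (V * (?b * (G * ?a)))))"
    using V(1) U(1) Z G by (intro mat_trace_commute[of _ N]) (simp_all add: ac)
  also have "mat_adjoint U * (mat_adjoint Z * (V * (?b * (G * ?a)))) = mat_adjoint G * (?b * (G * ?a))"
    using V(1) U(1) Z G by (simp add: G_def ac mat_adjoint_mult_adjoint[of _ N])
  also have "mat_trace \<dots> = (\<Sum>j<N. \<Sum>i<N. cnj (G $$ (i, j)) * (complex_of_real (b i ^ k) * (G $$ (i, j) * complex_of_real (a j ^ l))))"
    using G by (subst mat_trace_carrier[of _ N N])
      (auto simp: ac adjoint_times_entry[of _ N N _ N] mat_diag_mult_left[of _ N N] mat_diag_mult_right[of _ N N]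
        intro!: sum.cong simp del: index_mult_mat(1))
  also have "\<dots> = (\<Sum>j<N. \<Sum>i<N. complex_of_real ((cmod (G $$ (i, j)))\<^sup>2 * (b i ^ k * a j ^ l)))"
  proof (intro sum.cong refl)
    fix i j
    have "cnj (G $$ (i, j)) * G $$ (i, j) = complex_of_real ((cmod (G $$ (i, j)))\<^sup>2)"
      by (metis complex_norm_square mult.commute)
    then show "cnj (G $$ (i, j)) * (complex_of_real (b i ^ k) * (G $$ (i, j) * complex_of_real (a j ^ l)))
        = complex_of_real ((cmod (G $$ (i, j)))\<^sup>2 * (b i ^ k * a j ^ l))"
      by (simp add: algebra_simps)
  qed
  also have "\<dots> = complex_of_real (\<Sum>i<N. \<Sum>j<N. (cmod (G $$ (i, j)))\<^sup>2 * (b i ^ k * a j ^ l))"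
    by (subst sum.swap) simp
  finally show ?thesis unfolding G_def .
qed

text \<open>The terms for \<open>q\<close> and \<open>2s - q\<close> are paired: the two factors of
  \<open>(|x|^q - |y|^q) (|x|^(2s-q) - |y|^(2s-q))\<close> have the same sign.\<close>

lemma power_sum_le_endpoints:
  fixes x y :: real
  shows "(\<Sum>q\<le>2 * s. x ^ q * y ^ (2 * s - q)) \<le> real (2 * s + 1) / 2 * (x ^ (2 * s) + y ^ (2 * s))"
proof -
  let ?r = "2 * s"
  have rev: "(\<Sum>q\<le>?r. x ^ q * y ^ (?r - q)) = (\<Sum>q\<le>?r. x ^ (?r - q) * y ^ q)"
    by (rule sum.reindex_bij_witness[of _ "\<lambda>q. ?r - q" "\<lambda>q. ?r - q"]) auto
  have pair: "x ^ q * y ^ (?r - q) + x ^ (?r - q) * y ^ q \<le> x ^ ?r + y ^ ?r" if "q \<le> ?r" for q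
  proof -
    have "0 \<le> (\<bar>x\<bar> ^ q - \<bar>y\<bar> ^ q) * (\<bar>x\<bar> ^ (?r - q) - \<bar>y\<bar> ^ (?r - q))"
    proof (cases "\<bar>x\<bar> \<le> \<bar>y\<bar>")
      case True
      then show ?thesis by (intro mult_nonpos_nonpos) (auto intro!: power_mono)
    next
      case False
      then show ?thesis by (intro mult_nonneg_nonneg) (auto intro!: power_mono)
    qed
    also have "\<dots> = \<bar>x\<bar> ^ (q + (?r - q)) + \<bar>y\<bar> ^ (q + (?r - q)) - (\<bar>x\<bar> ^ q * \<bar>y\<bar> ^ (?r - q) + \<bar>x\<bar> ^ (?r - q) * \<bar>y\<bar> ^ q)"
      by (simp add: power_add algebra_simps)
    also have "q + (?r - q) = ?r" using that by simp
    finally have "\<bar>x\<bar> ^ q * \<bar>y\<bar> ^ (?r - q) + \<bar>x\<bar> ^ (?r - q) * \<bar>y\<bar> ^ q \<le> x ^ ?r + y ^ ?r"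
      by (simp add: power_even_abs)
    moreover have "x ^ q * y ^ (?r - q) \<le> \<bar>x\<bar> ^ q * \<bar>y\<bar> ^ (?r - q)"
      "x ^ (?r - q) * y ^ q \<le> \<bar>x\<bar> ^ (?r - q) * \<bar>y\<bar> ^ q"
      by (metis abs_ge_self abs_mult power_abs)+
    ultimately show ?thesis by linarith
  qed
  have "2 * (\<Sum>q\<le>?r. x ^ q * y ^ (?r - q)) = (\<Sum>q\<le>?r. x ^ q * y ^ (?r - q) + x ^ (?r - q) * y ^ q)"
    using rev by (simp add: sum.distrib)
  also have "\<dots> \<le> (\<Sum>q\<le>?r. x ^ ?r + y ^ ?r)" by (rule sum_mono) (use pair in auto)
  finally show ?thesis by (simp add: field_simps)
qed

text \<open>The scalar inequality \<open>power_sum_le_endpoints\<close>, transferred by \<open>trace_spectral\<close>.\<close>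

lemma trace_mixed_powers_le:
  assumes X: "hermitian_mat N X" and Y: "hermitian_mat N Y" and Z: "hermitian_mat N Z"
  shows "(\<Sum>q\<le>2 * s. Re (mat_trace (X * (Y ^\<^sub>m q * (X * Z ^\<^sub>m (2 * s - q))))))
    \<le> real (2 * s + 1) / 2 * (Re (mat_trace (X * (Y ^\<^sub>m (2 * s) * X))) + Re (mat_trace (X * (Z ^\<^sub>m (2 * s) * X))))"
proof -
  obtain V b where V: "eigendecomp N V b Y" using hermitian_eigendecomp[OF Y] by auto
  obtain U a where U: "eigendecomp N U a Z" using hermitian_eigendecomp[OF Z] by auto
  have cX: "X \<in> carrier_mat N N" and hX: "mat_adjoint X = X"
    and cY: "Y \<in> carrier_mat N N" and cZ: "Z \<in> carrier_mat N N"
    using X Y Z by (auto simp: hermitian_mat_def)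
  define g where "g i j = (cmod ((mat_adjoint V * (X * U)) $$ (i, j)))\<^sup>2" for i j
  have tr: "Re (mat_trace (X * (Y ^\<^sub>m k * (X * Z ^\<^sub>m l)))) = (\<Sum>i<N. \<Sum>j<N. g i j * (b i ^ k * a j ^ l))" for k l
    using trace_spectral[OF V U cX, of k l] hX by (simp add: g_def)
  have "(\<Sum>q\<le>2 * s. Re (mat_trace (X * (Y ^\<^sub>m q * (X * Z ^\<^sub>m (2 * s - q))))))
      = (\<Sum>i<N. \<Sum>j<N. g i j * (\<Sum>q\<le>2 * s. b i ^ q * a j ^ (2 * s - q)))"
    unfolding tr sum_distrib_left by (subst sum.swap, subst (2) sum.swap) simp
  also have "\<dots> \<le> (\<Sum>i<N. \<Sum>j<N. g i j * (real (2 * s + 1) / 2 * (b i ^ (2 * s) + a j ^ (2 * s))))"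
    by (intro sum_mono mult_left_mono power_sum_le_endpoints) (simp add: g_def)
  also have "\<dots> = real (2 * s + 1) / 2 * ((\<Sum>i<N. \<Sum>j<N. g i j * (b i ^ (2 * s) * a j ^ 0))
      + (\<Sum>i<N. \<Sum>j<N. g i j * (b i ^ 0 * a j ^ (2 * s))))"
    unfolding sum_distrib_left sum.distrib[symmetric]
    by (intro sum.cong refl) (simp add: algebra_simps)
  also have "(\<Sum>i<N. \<Sum>j<N. g i j * (b i ^ (2 * s) * a j ^ 0)) = Re (mat_trace (X * (Y ^\<^sub>m (2 * s) * X)))"
    unfolding tr[symmetric] using cX cZ by simp
  also have "(\<Sum>i<N. \<Sum>j<N. g i j * (b i ^ 0 * a j ^ (2 * s))) = Re (mat_trace (X * (X * Z ^\<^sub>m (2 * s))))"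
    unfolding tr[symmetric] using cX cY cZ by (simp add: mult_carrier_mat[of _ N N _ N] left_mult_one_mat[of _ N N])
  also have "mat_trace (X * (X * Z ^\<^sub>m (2 * s))) = mat_trace ((X * Z ^\<^sub>m (2 * s)) * X)"
    by (rule mat_trace_commute[OF cX]) (use cX cZ in \<open>simp add: mult_carrier_mat[of _ N N _ N]\<close>)
  also have "(X * Z ^\<^sub>m (2 * s)) * X = X * (Z ^\<^sub>m (2 * s) * X)"
    using cX cZ by (simp add: assoc_mult_mat[of _ N N _ N _ N])
  finally show ?thesis .
qed

text \<open>The noncommutative form of \<open>y^k - z^k = \<Sum> y^q (y - z) z^(k-1-q)\<close>, under the trace. The
  test matrix \<open>P\<close> is arbitrary because the induction moves a last factor \<open>Z\<close> around the
  trace and absorbs it into \<open>P\<close>.\<close>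

lemma trace_power_telescope:
  assumes P: "P \<in> carrier_mat N N" and X: "X \<in> carrier_mat N N" and Z: "Z \<in> carrier_mat N N"
  shows "mat_trace (P * (X + Z) ^\<^sub>m k) = mat_trace (P * Z ^\<^sub>m k)
    + (\<Sum>q<k. mat_trace (P * ((X + Z) ^\<^sub>m q * (X * Z ^\<^sub>m (k - 1 - q)))))"
  using P
proof (induction k arbitrary: P)
  case 0
  then show ?case using X Z by simp
next
  case (Suc k P)
  let ?Y = "X + Z"
  have Y: "?Y \<in> carrier_mat N N" using X Z by simp
  note ac = assoc_mult_mat[of _ N N _ N _ N] mult_carrier_mat[of _ N N _ N]
  note c = Suc.prems X Z Y pow_mat_carrier[OF Y] pow_mat_carrier[OF Z]
  have "P * ?Y ^\<^sub>m Suc k = P * (?Y ^\<^sub>m k * X) + P * (?Y ^\<^sub>m k * Z)"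
    unfolding pow_mat.simps using c
    by (simp add: mult_add_distrib_mat[of _ N N _ N] ac del: add_carrier_mat)
  then have "mat_trace (P * ?Y ^\<^sub>m Suc k) = mat_trace (P * (?Y ^\<^sub>m k * X)) + mat_trace (P * (?Y ^\<^sub>m k * Z))"
    using c by (simp add: mat_trace_add[of _ N] ac del: add_carrier_mat)
  also have "mat_trace (P * (?Y ^\<^sub>m k * Z)) = mat_trace ((P * ?Y ^\<^sub>m k) * Z)" using c by (simp add: ac)
  also have "\<dots> = mat_trace ((Z * P) * ?Y ^\<^sub>m k)"
    using c by (subst mat_trace_commute[of _ N]) (simp_all add: ac)
  also have "\<dots> = mat_trace ((Z * P) * Z ^\<^sub>m k)
    + (\<Sum>q<k. mat_trace ((Z * P) * (?Y ^\<^sub>m q * (X * Z ^\<^sub>m (k - 1 - q)))))"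
    by (rule Suc.IH) (use c in \<open>simp add: ac\<close>)
  also have "mat_trace ((Z * P) * Z ^\<^sub>m k) = mat_trace (P * Z ^\<^sub>m Suc k)"
  proof -
    have "mat_trace ((Z * P) * Z ^\<^sub>m k) = mat_trace (Z * (P * Z ^\<^sub>m k))" using c by (simp add: ac)
    also have "\<dots> = mat_trace ((P * Z ^\<^sub>m k) * Z)" using c by (subst mat_trace_commute[of _ N]) (simp_all add: ac)
    also have "\<dots> = mat_trace (P * Z ^\<^sub>m Suc k)" using c by (simp add: ac)
    finally show ?thesis .
  qed
  also have "(\<Sum>q<k. mat_trace ((Z * P) * (?Y ^\<^sub>m q * (X * Z ^\<^sub>m (k - 1 - q)))))
     = (\<Sum>q<k. mat_trace (P * (?Y ^\<^sub>m q * (X * Z ^\<^sub>m (Suc k - 1 - q)))))"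
  proof (rule sum.cong[OF refl])
    fix q assume "q \<in> {..<k}"
    then have e: "Suc k - 1 - q = Suc (k - 1 - q)" by auto
    have "mat_trace ((Z * P) * (?Y ^\<^sub>m q * (X * Z ^\<^sub>m (k - 1 - q))))
        = mat_trace (Z * (P * (?Y ^\<^sub>m q * (X * Z ^\<^sub>m (k - 1 - q)))))" using c by (simp add: ac)
    also have "\<dots> = mat_trace ((P * (?Y ^\<^sub>m q * (X * Z ^\<^sub>m (k - 1 - q)))) * Z)"
      using c by (subst mat_trace_commute[of _ N]) (simp_all add: ac)
    also have "\<dots> = mat_trace (P * (?Y ^\<^sub>m q * (X * Z ^\<^sub>m (Suc k - 1 - q))))"
      unfolding e using c by (simp add: ac)
    finally show "mat_trace ((Z * P) * (?Y ^\<^sub>m q * (X * Z ^\<^sub>m (k - 1 - q))))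
      = mat_trace (P * (?Y ^\<^sub>m q * (X * Z ^\<^sub>m (Suc k - 1 - q))))" .
  qed
  finally show ?case using c by simp
qed

lemma frob_norm_sq_entries:
  assumes "A \<in> carrier_mat N M"
  shows "frob_norm_sq A = (\<Sum>j<M. \<Sum>i<N. (cmod (A $$ (i, j)))\<^sup>2)"
proof -
  have "mat_trace (mat_adjoint A * A) = (\<Sum>j<M. \<Sum>i<N. cnj (A $$ (i, j)) * A $$ (i, j))"
    using assms by (subst mat_trace_carrier[of _ M M])
      (auto intro!: sum.cong mult_carrier_mat[of _ M N _ M] simp: adjoint_times_entry[OF assms assms]
        simp del: index_mult_mat(1))
  also have "\<dots> = (\<Sum>j<M. \<Sum>i<N. complex_of_real ((cmod (A $$ (i, j)))\<^sup>2))"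
    by (intro sum.cong refl) (metis complex_norm_square mult.commute)
  finally show ?thesis by (simp add: frob_norm_sq_def)
qed

text \<open>The operator norm enters through its square, which avoids square roots of the bounds. Vectors
  are functions on all natural numbers of which only the first \<open>N\<close> values count, so
  that block indices can be handled by plain reindexing of sums.\<close>

definition op_norm_sq_le :: "nat \<Rightarrow> complex mat \<Rightarrow> real \<Rightarrow> bool" where
  "op_norm_sq_le N A C \<longleftrightarrow>
     (\<forall>v. (\<Sum>i<N. (cmod (\<Sum>j<N. A $$ (i, j) * v j))\<^sup>2) \<le> C * (\<Sum>j<N. (cmod (v j))\<^sup>2))"

lemma frob_norm_sq_times_le:
  assumes A: "A \<in> carrier_mat N N" and B: "B \<in> carrier_mat N N" and C: "op_norm_sq_le N A C"
  shows "frob_norm_sq (A * B) \<le> C * frob_norm_sq B"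
proof -
  have AB: "A * B \<in> carrier_mat N N" using A B by simp
  have "frob_norm_sq (A * B) = (\<Sum>j<N. \<Sum>i<N. (cmod (\<Sum>l<N. A $$ (i, l) * B $$ (l, j)))\<^sup>2)"
    unfolding frob_norm_sq_entries[OF AB] by (intro sum.cong refl) (simp add: mat_times_entry[OF A B] del: index_mult_mat(1))
  also have "\<dots> \<le> (\<Sum>j<N. C * (\<Sum>l<N. (cmod (B $$ (l, j)))\<^sup>2))"
    using C by (intro sum_mono) (auto simp: op_norm_sq_le_def)
  finally show ?thesis unfolding frob_norm_sq_entries[OF B] by (simp add: sum_distrib_left)
qed

lemma pow_mat_add:
  assumes "A \<in> carrier_mat N N"
  shows "A ^\<^sub>m (k + l) = A ^\<^sub>m k * A ^\<^sub>m l"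
proof (induction l)
  case 0
  then show ?case using assms by (simp add: right_mult_one_mat[of _ N N])
next
  case (Suc l)
  then show ?case using assms by (simp add: assoc_mult_mat[of _ N N _ N _ N])
qed

lemma hermitian_pow:
  assumes "hermitian_mat N A"
  shows "hermitian_mat N (A ^\<^sub>m k)"
proof -
  have A: "A \<in> carrier_mat N N" "mat_adjoint A = A" using assms by (auto simp: hermitian_mat_def)
  have "mat_adjoint (A ^\<^sub>m k) = A ^\<^sub>m k"
  proof (induction k)
    case 0
    then show ?case by (intro eq_matI) auto
  next
    case (Suc k)
    have "mat_adjoint (A ^\<^sub>m Suc k) = A * A ^\<^sub>m k"
      using A Suc by (simp add: mat_adjoint_mult_adjoint[of _ N])
    also have "\<dots> = A ^\<^sub>m (1 + k)" unfolding pow_mat_add[OF A(1)] using A by simp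
    finally show ?case by simp
  qed
  then show ?thesis using A by (simp add: hermitian_mat_def)
qed

lemma trace_even_power:
  assumes "hermitian_mat N Y"
  shows "Re (mat_trace (Y ^\<^sub>m (2 * s))) = frob_norm_sq (Y ^\<^sub>m s)"
proof -
  have "mat_adjoint (Y ^\<^sub>m s) = Y ^\<^sub>m s" "Y \<in> carrier_mat N N"
    using hermitian_pow[OF assms, of s] assms by (auto simp: hermitian_mat_def)
  then show ?thesis using pow_mat_add[of Y N s s] by (simp add: frob_norm_sq_def mult_2)
qed

text \<open>By cyclicity the left-hand side is the squared Frobenius norm of \<open>X Y^s\<close>, to which the bound on
  \<open>X\<close> applies column by column.\<close>

lemma trace_sandwich_le:
  assumes X: "hermitian_mat N X" and Y: "hermitian_mat N Y" and C: "op_norm_sq_le N X C"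
  shows "Re (mat_trace (X * (Y ^\<^sub>m (2 * s) * X))) \<le> C * Re (mat_trace (Y ^\<^sub>m (2 * s)))"
proof -
  let ?P = "Y ^\<^sub>m s"
  have h: "X \<in> carrier_mat N N" "?P \<in> carrier_mat N N" "mat_adjoint X = X" "mat_adjoint ?P = ?P"
    and cY: "Y \<in> carrier_mat N N"
    using X Y hermitian_pow[OF Y, of s] by (auto simp: hermitian_mat_def)
  note ac = assoc_mult_mat[of _ N N _ N _ N] mult_carrier_mat[of _ N N _ N]
  have "mat_trace (X * (Y ^\<^sub>m (2 * s) * X)) = mat_trace ((X * ?P) * (?P * X))"
    unfolding mult_2 pow_mat_add[OF cY] using h by (simp add: ac)
  also have "\<dots> = mat_trace ((?P * X) * (X * ?P))"
    using h by (intro mat_trace_commute[of _ N]) (simp_all add: ac)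
  also have "?P * X = mat_adjoint (X * ?P)" using h by (simp add: mat_adjoint_mult_adjoint[of _ N])
  finally have "Re (mat_trace (X * (Y ^\<^sub>m (2 * s) * X))) = frob_norm_sq (X * ?P)"
    by (simp add: frob_norm_sq_def)
  also have "\<dots> \<le> C * frob_norm_sq ?P" by (rule frob_norm_sq_times_le[OF h(1,2) C])
  finally show ?thesis unfolding trace_even_power[OF Y] .
qed

section \<open>Even moments of sums of independent random matrices\<close>

text \<open>The expectation of \<open>f\<close> when the coordinates in \<open>J\<close> are drawn independently from \<open>\<Omega>\<close>
  with weights \<open>p i\<close>. The measurements have finitely many outcomes, so these finite sums carry
  the whole probabilistic argument.\<close>

definition prod_expect :: "'i set \<Rightarrow> 'x set \<Rightarrow> ('i \<Rightarrow> 'x \<Rightarrow> real) \<Rightarrow> (('i \<Rightarrow> 'x) \<Rightarrow> real) \<Rightarrow> real" where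
  "prod_expect J \<Omega> p f = (\<Sum>d\<in>J \<rightarrow>\<^sub>E \<Omega>. (\<Prod>i\<in>J. p i (d i)) * f d)"

lemma prod_expect_split:
  assumes J: "finite J" "i \<in> J"
  shows "prod_expect J \<Omega> p f = prod_expect (J - {i}) \<Omega> p (\<lambda>d. \<Sum>x\<in>\<Omega>. p i x * f (d(i := x)))"
proof -
  let ?K = "J - {i}"
  have JK: "J = insert i ?K" using J by auto
  have K: "finite ?K" "i \<notin> ?K" using J by auto
  have "prod_expect J \<Omega> p f = (\<Sum>d\<in>insert i ?K \<rightarrow>\<^sub>E \<Omega>. (\<Prod>i\<in>J. p i (d i)) * f d)"
    unfolding prod_expect_def using JK by simp
  also have "\<dots> = (\<Sum>(x, d)\<in>\<Omega> \<times> (?K \<rightarrow>\<^sub>E \<Omega>). (\<Prod>j\<in>J. p j ((d(i := x)) j)) * f (d(i := x)))"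
    unfolding PiE_insert_eq sum.reindex[OF inj_combinator[OF K(2), of "\<lambda>_. \<Omega>"]]
    by (simp add: o_def split_beta)
  also have "\<dots> = (\<Sum>d\<in>?K \<rightarrow>\<^sub>E \<Omega>. \<Sum>x\<in>\<Omega>. (\<Prod>j\<in>J. p j ((d(i := x)) j)) * f (d(i := x)))"
    unfolding sum.cartesian_product[symmetric] by (rule sum.swap)
  also have "\<dots> = prod_expect ?K \<Omega> p (\<lambda>d. \<Sum>x\<in>\<Omega>. p i x * f (d(i := x)))"
    unfolding prod_expect_def sum_distrib_left
  proof (intro sum.cong refl)
    fix d x
    have "(\<Prod>j\<in>J. p j ((d(i := x)) j)) = p i x * (\<Prod>j\<in>?K. p j (d j))"
      by (subst prod.remove[OF J]) (auto intro!: prod.cong)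
    then show "(\<Prod>j\<in>J. p j ((d(i := x)) j)) * f (d(i := x)) = (\<Prod>j\<in>?K. p j (d j)) * (p i x * f (d(i := x)))"
      by simp
  qed
  finally show ?thesis .
qed

text \<open>Entrywise, because the matrices of a fixed size do not form a type over which \<open>sum\<close> could
  range.\<close>

definition matrix_sum :: "nat \<Rightarrow> 'i set \<Rightarrow> ('i \<Rightarrow> complex mat) \<Rightarrow> complex mat" where
  "matrix_sum N J F = mat N N (\<lambda>(k, l). \<Sum>i\<in>J. F i $$ (k, l))"

lemma matrix_sum_carrier [simp]: "matrix_sum N J F \<in> carrier_mat N N"
  by (simp add: matrix_sum_def)

lemma matrix_sum_dim [simp]: "dim_row (matrix_sum N J F) = N" "dim_col (matrix_sum N J F) = N"
  by (simp_all add: matrix_sum_def)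

lemma matrix_sum_remove:
  assumes "finite J" "i \<in> J" "F i \<in> carrier_mat N N"
  shows "matrix_sum N J F = F i + matrix_sum N (J - {i}) F"
  using assms by (intro eq_matI) (auto simp: matrix_sum_def sum.remove)

lemma matrix_sum_cong:
  "(\<And>i. i \<in> J \<Longrightarrow> F i = G i) \<Longrightarrow> matrix_sum N J F = matrix_sum N J G"
  unfolding matrix_sum_def by (intro cong_mat) auto

lemma hermitian_matrix_sum:
  assumes "\<And>i. i \<in> J \<Longrightarrow> hermitian_mat N (F i)"
  shows "hermitian_mat N (matrix_sum N J F)"
proof -
  have "mat_adjoint (matrix_sum N J F) = matrix_sum N J F"
  proof (rule eq_matI)
    fix k l assume "k < dim_row (matrix_sum N J F)" "l < dim_col (matrix_sum N J F)"
    then have kl: "k < N" "l < N" by (auto simp: matrix_sum_def)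
    have "cnj (F i $$ (l, k)) = F i $$ (k, l)" if "i \<in> J" for i
    proof -
      have h: "F i \<in> carrier_mat N N" "mat_adjoint (F i) = F i"
        using assms[OF that] by (auto simp: hermitian_mat_def)
      then show ?thesis using mat_adjoint_entry[of k "F i" l] kl by simp
    qed
    then show "mat_adjoint (matrix_sum N J F) $$ (k, l) = matrix_sum N J F $$ (k, l)"
      using kl by (simp add: matrix_sum_def)
  qed (auto simp: matrix_sum_def)
  then show ?thesis by (simp add: hermitian_mat_def)
qed

lemma mat_trace_matrix_sum_times:
  assumes "\<And>i. i \<in> J \<Longrightarrow> F i \<in> carrier_mat N N" "B \<in> carrier_mat N N"
  shows "mat_trace (matrix_sum N J F * B) = (\<Sum>i\<in>J. mat_trace (F i * B))"
proof -
  have "mat_trace (matrix_sum N J F * B) = (\<Sum>k<N. \<Sum>l<N. \<Sum>i\<in>J. F i $$ (k, l) * B $$ (l, k))"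
    using assms by (subst mat_trace_times[of _ N]) (auto simp: matrix_sum_def sum_distrib_right)
  also have "\<dots> = (\<Sum>i\<in>J. \<Sum>k<N. \<Sum>l<N. F i $$ (k, l) * B $$ (l, k))"
    by (subst (2) sum.swap, subst sum.swap) simp
  finally show ?thesis using assms by (simp add: mat_trace_times[of _ N])
qed

text \<open>The double factorial \<open>(2s - 1)!!\<close>, which is the moment of order \<open>2s\<close> of a standard Gaussian
  variable.\<close>

fun odd_factorial :: "nat \<Rightarrow> real" where
  "odd_factorial 0 = 1"
| "odd_factorial (Suc s) = real (2 * s + 1) * odd_factorial s"

lemma odd_factorial_nonneg: "0 \<le> odd_factorial s"
  by (induction s) auto

text \<open>The induction step is \<open>2 s^s \<le> (s + 1)^s\<close>, which is Bernoulli's inequality for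
  \<open>(1 + 1/s)^s\<close>.\<close>

lemma odd_factorial_le: "odd_factorial s \<le> real s ^ s"
proof (induction s)
  case (Suc s)
  show ?case
  proof (cases "s = 0")
    case False
    have "2 \<le> (1 + 1 / real s) ^ s"
      using Bernoulli_inequality[of "1 / real s" s] order_trans[of "-1" 0 "1 / real s"] False by simp
    then have "2 * real s ^ s \<le> (1 + 1 / real s) ^ s * real s ^ s"
      by (intro mult_right_mono) auto
    also have "\<dots> = real (Suc s) ^ s"
      using False by (simp add: power_mult_distrib[symmetric] field_simps)
    finally have *: "2 * real s ^ s \<le> real (Suc s) ^ s" .
    have "odd_factorial (Suc s) \<le> real (2 * s + 1) * real s ^ s"
      using Suc by (simp add: mult_left_mono)
    also have "\<dots> \<le> real (Suc s) * (2 * real s ^ s)" by (simp add: algebra_simps)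
    also have "\<dots> \<le> real (Suc s) * real (Suc s) ^ s" using * by (intro mult_left_mono) auto
    finally show ?thesis by simp
  qed auto
qed auto

text \<open>Centered Hermitian matrices, the one with index \<open>i\<close> taking the value \<open>X i x\<close> with probability
  \<open>p i x\<close>. Their independence resides in the product weights of \<open>prod_expect\<close>.\<close>

locale centered_matrix_family =
  fixes N :: nat and I :: "'i set" and \<Omega> :: "'x set" and p :: "'i \<Rightarrow> 'x \<Rightarrow> real"
    and X :: "'i \<Rightarrow> 'x \<Rightarrow> complex mat" and C :: real
  assumes finite_I: "finite I" and finite_Om: "finite \<Omega>"
    and p_nonneg: "\<And>i x. i \<in> I \<Longrightarrow> x \<in> \<Omega> \<Longrightarrow> 0 \<le> p i x"
    and p_sum: "\<And>i. i \<in> I \<Longrightarrow> (\<Sum>x\<in>\<Omega>. p i x) = 1"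
    and herm: "\<And>i x. i \<in> I \<Longrightarrow> x \<in> \<Omega> \<Longrightarrow> hermitian_mat N (X i x)"
    and bound: "\<And>i x. i \<in> I \<Longrightarrow> x \<in> \<Omega> \<Longrightarrow> op_norm_sq_le N (X i x) C"
    and C_nonneg: "0 \<le> C"
    and centered: "\<And>i k l. i \<in> I \<Longrightarrow> k < N \<Longrightarrow> l < N \<Longrightarrow>
      (\<Sum>x\<in>\<Omega>. complex_of_real (p i x) * X i x $$ (k, l)) = 0"
begin

abbreviation total :: "'i set \<Rightarrow> ('i \<Rightarrow> 'x) \<Rightarrow> complex mat" where
  "total J d \<equiv> matrix_sum N J (\<lambda>i. X i (d i))"

definition moment :: "'i set \<Rightarrow> nat \<Rightarrow> real" where
  "moment J s = prod_expect J \<Omega> p (\<lambda>d. Re (mat_trace (total J d ^\<^sub>m (2 * s))))"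

lemma prod_weight_nonneg:
  assumes "J \<subseteq> I" "d \<in> J \<rightarrow>\<^sub>E \<Omega>"
  shows "0 \<le> (\<Prod>i\<in>J. p i (d i))"
  using assms p_nonneg by (intro prod_nonneg) (auto simp: PiE_iff)

lemma prod_expect_mono:
  assumes "J \<subseteq> I" "\<And>d. d \<in> J \<rightarrow>\<^sub>E \<Omega> \<Longrightarrow> f d \<le> g d"
  shows "prod_expect J \<Omega> p f \<le> prod_expect J \<Omega> p g"
  unfolding prod_expect_def using assms prod_weight_nonneg[OF assms(1)]
  by (intro sum_mono mult_left_mono) auto

lemma prod_expect_1:
  assumes "J \<subseteq> I"
  shows "prod_expect J \<Omega> p (\<lambda>_. c) = c"
proof -
  have "finite J" using assms finite_I finite_subset by blast
  then have "(\<Sum>d\<in>J \<rightarrow>\<^sub>E \<Omega>. \<Prod>i\<in>J. p i (d i)) = (\<Prod>i\<in>J. \<Sum>x\<in>\<Omega>. p i x)"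
    by (rule prod_sum_PiE[symmetric]) (use finite_Om in auto)
  also have "\<dots> = 1" using p_sum assms by (intro prod.neutral) auto
  finally show ?thesis unfolding prod_expect_def sum_distrib_right[symmetric] by simp
qed

lemma hermitian_total: "J \<subseteq> I \<Longrightarrow> d \<in> J \<rightarrow>\<^sub>E \<Omega> \<Longrightarrow> hermitian_mat N (total J d)"
  by (intro hermitian_matrix_sum herm) (auto simp: PiE_iff)

lemma centered_trace:
  assumes i: "i \<in> I" and B: "B \<in> carrier_mat N N"
  shows "(\<Sum>x\<in>\<Omega>. p i x * Re (mat_trace (X i x * B))) = 0"
proof -
  have XB: "mat_trace (X i x * B) = (\<Sum>k<N. \<Sum>l<N. X i x $$ (k, l) * B $$ (l, k))" if "x \<in> \<Omega>" for x
    using herm[OF i that] B by (intro mat_trace_times) (auto simp: hermitian_mat_def)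
  have "(\<Sum>x\<in>\<Omega>. complex_of_real (p i x) * mat_trace (X i x * B))
      = (\<Sum>x\<in>\<Omega>. \<Sum>k<N. \<Sum>l<N. complex_of_real (p i x) * X i x $$ (k, l) * B $$ (l, k))"
    by (intro sum.cong) (simp_all add: XB sum_distrib_left mult.assoc)
  also have "\<dots> = (\<Sum>k<N. \<Sum>l<N. (\<Sum>x\<in>\<Omega>. complex_of_real (p i x) * X i x $$ (k, l)) * B $$ (l, k))"
    unfolding sum_distrib_right by (subst sum.swap, subst (2) sum.swap) simp
  also have "\<dots> = 0" using centered[OF i] by simp
  finally have "Re (\<Sum>x\<in>\<Omega>. complex_of_real (p i x) * mat_trace (X i x * B)) = 0" by simp
  then show ?thesis by simp
qed

text \<open>With the other coordinates fixed, \<open>Z = Y - X\<^sub>i\<close> is constant and \<open>X\<^sub>i\<close> is centered,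
  so \<open>tr (X\<^sub>i Z^(2s+1))\<close> may be subtracted for free. The difference telescopes into terms with
  two factors \<open>X\<^sub>i\<close>: the end terms dominate, and in them \<open>X\<^sub>i\<close> is replaced by its norm bound.\<close>

lemma single_term_bound:
  assumes J: "J \<subseteq> I" and i: "i \<in> J"
  shows "prod_expect J \<Omega> p (\<lambda>d. Re (mat_trace (X i (d i) * total J d ^\<^sub>m (2 * s + 1))))
    \<le> real (2 * s + 1) / 2 * C * (moment J s + moment (J - {i}) s)"
proof -
  let ?K = "J - {i}"
  have fJ: "finite J" using J finite_I finite_subset by blast
  have iI: "i \<in> I" and KI: "?K \<subseteq> I" using i J by auto
  let ?c = "real (2 * s + 1) / 2 * C"
  have total_K: "total ?K (d(i := x)) = total ?K d" for x d by (intro matrix_sum_cong) auto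
  have total_upd: "total J (d(i := x)) = X i x + total ?K d" if "x \<in> \<Omega>" for x d
  proof -
    have "X i x \<in> carrier_mat N N" using herm[OF iI that] by (auto simp: hermitian_mat_def)
    then show "total J (d(i := x)) = X i x + total ?K d"
      using matrix_sum_remove[of J i "\<lambda>j. X j ((d(i := x)) j)" N] fJ i total_K by simp
  qed
  have inner: "(\<Sum>x\<in>\<Omega>. p i x * Re (mat_trace (X i x * total J (d(i := x)) ^\<^sub>m (2 * s + 1))))
      \<le> (\<Sum>x\<in>\<Omega>. p i x * (?c * (Re (mat_trace (total J (d(i := x)) ^\<^sub>m (2 * s))) + Re (mat_trace (total ?K d ^\<^sub>m (2 * s))))))"
    if d: "d \<in> ?K \<rightarrow>\<^sub>E \<Omega>" for d
  proof -
    let ?Z = "total ?K d"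
    have Z: "hermitian_mat N ?Z" by (rule hermitian_total[OF KI d])
    have step: "Re (mat_trace (X i x * total J (d(i := x)) ^\<^sub>m (2 * s + 1))) - Re (mat_trace (X i x * ?Z ^\<^sub>m (2 * s + 1)))
        \<le> ?c * (Re (mat_trace (total J (d(i := x)) ^\<^sub>m (2 * s))) + Re (mat_trace (?Z ^\<^sub>m (2 * s))))"
      if x: "x \<in> \<Omega>" for x
    proof -
      let ?X = "X i x" and ?Y = "total J (d(i := x))"
      have X: "hermitian_mat N ?X" by (rule herm[OF iI x])
      have "d(i := x) \<in> J \<rightarrow>\<^sub>E \<Omega>" using d x i by (auto simp: PiE_iff extensional_def)
      then have hY: "hermitian_mat N ?Y" by (rule hermitian_total[OF J])
      have cX: "?X \<in> carrier_mat N N" using X by (auto simp: hermitian_mat_def)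
      have "{..<2 * s + 1} = {..2 * s}" by auto
      then have "mat_trace (?X * ?Y ^\<^sub>m (2 * s + 1)) = mat_trace (?X * ?Z ^\<^sub>m (2 * s + 1))
        + (\<Sum>q\<le>2 * s. mat_trace (?X * (?Y ^\<^sub>m q * (?X * ?Z ^\<^sub>m (2 * s - q)))))"
        using trace_power_telescope[OF cX cX, of ?Z "2 * s + 1"] unfolding total_upd[OF x] by simp
      then have "Re (mat_trace (?X * ?Y ^\<^sub>m (2 * s + 1))) - Re (mat_trace (?X * ?Z ^\<^sub>m (2 * s + 1)))
        = (\<Sum>q\<le>2 * s. Re (mat_trace (?X * (?Y ^\<^sub>m q * (?X * ?Z ^\<^sub>m (2 * s - q))))))"
        by simp
      also have "\<dots> \<le> real (2 * s + 1) / 2 * (Re (mat_trace (?X * (?Y ^\<^sub>m (2 * s) * ?X))) + Re (mat_trace (?X * (?Z ^\<^sub>m (2 * s) * ?X))))"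
        by (rule trace_mixed_powers_le[OF X hY Z])
      also have "\<dots> \<le> real (2 * s + 1) / 2 * (C * Re (mat_trace (?Y ^\<^sub>m (2 * s))) + C * Re (mat_trace (?Z ^\<^sub>m (2 * s))))"
        by (intro mult_left_mono add_mono trace_sandwich_le[OF X hY bound[OF iI x]]
            trace_sandwich_le[OF X Z bound[OF iI x]]) auto
      finally show ?thesis by (simp add: algebra_simps)
    qed
    have "(\<Sum>x\<in>\<Omega>. p i x * Re (mat_trace (X i x * total J (d(i := x)) ^\<^sub>m (2 * s + 1))))
      = (\<Sum>x\<in>\<Omega>. p i x * (Re (mat_trace (X i x * total J (d(i := x)) ^\<^sub>m (2 * s + 1))) - Re (mat_trace (X i x * ?Z ^\<^sub>m (2 * s + 1)))))"
      using centered_trace[OF iI, of "?Z ^\<^sub>m (2 * s + 1)"]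
      by (simp only: right_diff_distrib sum_subtractf) (simp del: pow_mat.simps)
    also have "\<dots> \<le> (\<Sum>x\<in>\<Omega>. p i x * (?c * (Re (mat_trace (total J (d(i := x)) ^\<^sub>m (2 * s))) + Re (mat_trace (?Z ^\<^sub>m (2 * s))))))"
      using step p_nonneg[OF iI] by (intro sum_mono mult_left_mono) auto
    finally show ?thesis .
  qed
  have "prod_expect J \<Omega> p (\<lambda>d. Re (mat_trace (X i (d i) * total J d ^\<^sub>m (2 * s + 1))))
      = prod_expect ?K \<Omega> p (\<lambda>d. \<Sum>x\<in>\<Omega>. p i x * Re (mat_trace (X i x * total J (d(i := x)) ^\<^sub>m (2 * s + 1))))"
    by (subst prod_expect_split[OF fJ i]) (simp del: pow_mat.simps)
  also have "\<dots> \<le> prod_expect ?K \<Omega> p (\<lambda>d. \<Sum>x\<in>\<Omega>. p i x * (?c * (Re (mat_trace (total J (d(i := x)) ^\<^sub>m (2 * s))) + Re (mat_trace (total ?K d ^\<^sub>m (2 * s))))))"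
    by (rule prod_expect_mono[OF KI inner])
  also have "\<dots> = prod_expect J \<Omega> p (\<lambda>d. ?c * (Re (mat_trace (total J d ^\<^sub>m (2 * s))) + Re (mat_trace (total ?K d ^\<^sub>m (2 * s)))))"
    unfolding prod_expect_split[OF fJ i] by (simp only: total_K)
  also have "\<dots> = ?c * (moment J s + prod_expect J \<Omega> p (\<lambda>d. Re (mat_trace (total ?K d ^\<^sub>m (2 * s)))))"
    unfolding moment_def prod_expect_def sum.distrib[symmetric] sum_distrib_left
    by (intro sum.cong refl) (simp add: algebra_simps)
  also have "prod_expect J \<Omega> p (\<lambda>d. Re (mat_trace (total ?K d ^\<^sub>m (2 * s)))) = moment ?K s"
  proof -
    have "(\<Sum>x\<in>\<Omega>. p i x * Re (mat_trace (total ?K (d(i := x)) ^\<^sub>m (2 * s)))) = Re (mat_trace (total ?K d ^\<^sub>m (2 * s)))" for d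
      unfolding total_K sum_distrib_right[symmetric] p_sum[OF iI] by simp
    then show ?thesis unfolding prod_expect_split[OF fJ i] moment_def by simp
  qed
  finally show ?thesis .
qed

text \<open>A Gaussian moment recursion in the style of the noncommutative Khintchine inequality, by
  summing \<open>single_term_bound\<close> over \<open>i\<close>. The bound is proved for all index sets at once since the
  recursion refers to sums with one term removed.\<close>

theorem moment_bound:
  assumes "J \<subseteq> I"
  shows "moment J s \<le> real N * odd_factorial s * (real (card J) * C) ^ s"
  using assms
proof (induction s arbitrary: J)
  case 0
  have "moment J 0 = prod_expect J \<Omega> p (\<lambda>d. real N)"
    unfolding moment_def by (simp add: mat_trace_carrier[of _ N N])
  then show ?case using prod_expect_1[OF 0] by simp
next
  case (Suc s J)
  have fJ: "finite J" using Suc.prems finite_I finite_subset by blast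
  let ?B = "real N * odd_factorial s * (real (card J) * C) ^ s"
  have B: "moment K s \<le> ?B" if "K \<subseteq> J" for K
  proof -
    have "moment K s \<le> real N * odd_factorial s * (real (card K) * C) ^ s"
      using Suc that by blast
    also have "\<dots> \<le> ?B"
      using that fJ C_nonneg card_mono[OF fJ that] odd_factorial_nonneg
      by (intro mult_left_mono power_mono mult_right_mono) auto
    finally show ?thesis .
  qed
  have "moment J (Suc s) = (\<Sum>i\<in>J. prod_expect J \<Omega> p (\<lambda>d. Re (mat_trace (X i (d i) * total J d ^\<^sub>m (2 * s + 1)))))"
  proof -
    have "Re (mat_trace (total J d ^\<^sub>m (2 * Suc s))) = (\<Sum>i\<in>J. Re (mat_trace (X i (d i) * total J d ^\<^sub>m (2 * s + 1))))"
      if d: "d \<in> J \<rightarrow>\<^sub>E \<Omega>" for d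
    proof -
      have "total J d ^\<^sub>m (2 * Suc s) = total J d ^\<^sub>m (1 + (2 * s + 1))" by (simp del: pow_mat.simps)
      also have "\<dots> = total J d * total J d ^\<^sub>m (2 * s + 1)"
        by (subst pow_mat_add[of _ N]) simp_all
      also have "mat_trace \<dots> = (\<Sum>i\<in>J. mat_trace (X i (d i) * total J d ^\<^sub>m (2 * s + 1)))"
        using herm Suc.prems d
        by (intro mat_trace_matrix_sum_times[of _ _ N]) (auto simp: hermitian_mat_def PiE_iff simp del: pow_mat.simps)
      finally show ?thesis by simp
    qed
    then have "moment J (Suc s) = prod_expect J \<Omega> p (\<lambda>d. \<Sum>i\<in>J. Re (mat_trace (X i (d i) * total J d ^\<^sub>m (2 * s + 1))))"
      unfolding moment_def prod_expect_def by (intro sum.cong refl) simp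
    also have "\<dots> = (\<Sum>i\<in>J. prod_expect J \<Omega> p (\<lambda>d. Re (mat_trace (X i (d i) * total J d ^\<^sub>m (2 * s + 1)))))"
      unfolding prod_expect_def sum_distrib_left by (rule sum.swap)
    finally show ?thesis .
  qed
  also have "\<dots> \<le> (\<Sum>i\<in>J. real (2 * s + 1) / 2 * C * (moment J s + moment (J - {i}) s))"
    by (intro sum_mono single_term_bound Suc.prems)
  also have "\<dots> \<le> (\<Sum>i\<in>J. real (2 * s + 1) / 2 * C * (?B + ?B))"
    using C_nonneg by (intro sum_mono mult_left_mono add_mono B) auto
  also have "\<dots> = real N * odd_factorial (Suc s) * (real (card J) * C) ^ Suc s"
    by simp
  finally show ?case .
qed

text \<open>Markov's inequality for the nonnegative variable \<open>tr Y^(2s)\<close>, with the double factorial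
  replaced by \<open>s^s\<close>.\<close>

theorem tail_bound:
  assumes "\<tau> > 0"
  shows "(\<Sum>d | d \<in> I \<rightarrow>\<^sub>E \<Omega> \<and> Re (mat_trace (total I d ^\<^sub>m (2 * s))) \<ge> \<tau> ^ s. \<Prod>i\<in>I. p i (d i))
    \<le> real N * (real s * (real (card I) * C) / \<tau>) ^ s"
proof -
  let ?t = "\<lambda>d. Re (mat_trace (total I d ^\<^sub>m (2 * s)))"
  let ?B = "{d. d \<in> I \<rightarrow>\<^sub>E \<Omega> \<and> ?t d \<ge> \<tau> ^ s}"
  have fin: "finite (I \<rightarrow>\<^sub>E \<Omega>)" using finite_I finite_Om by (simp add: finite_PiE)
  have tpos: "0 \<le> ?t d" if "d \<in> I \<rightarrow>\<^sub>E \<Omega>" for d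
    unfolding trace_even_power[OF hermitian_total[OF subset_refl that]]
    by (subst frob_norm_sq_entries[of _ N N]) (auto intro!: sum_nonneg)
  have "\<tau> ^ s * (\<Sum>d\<in>?B. \<Prod>i\<in>I. p i (d i)) = (\<Sum>d\<in>?B. (\<Prod>i\<in>I. p i (d i)) * \<tau> ^ s)"
    by (simp add: sum_distrib_left mult.commute)
  also have "\<dots> \<le> (\<Sum>d\<in>?B. (\<Prod>i\<in>I. p i (d i)) * ?t d)"
    by (intro sum_mono mult_left_mono prod_weight_nonneg) auto
  also have "\<dots> \<le> moment I s"
    unfolding moment_def prod_expect_def
    by (rule sum_mono2[OF fin]) (auto intro!: mult_nonneg_nonneg prod_weight_nonneg tpos)
  also have "\<dots> \<le> real N * odd_factorial s * (real (card I) * C) ^ s"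
    by (rule moment_bound) simp
  also have "\<dots> \<le> real N * real s ^ s * (real (card I) * C) ^ s"
    using C_nonneg odd_factorial_le by (intro mult_right_mono mult_left_mono) auto
  also have "\<dots> = \<tau> ^ s * (real N * (real s * (real (card I) * C) / \<tau>) ^ s)"
    using assms by (simp add: power_mult_distrib power_divide)
  finally show ?thesis using assms by (simp add: mult_le_cancel_left_pos)
qed

end

section \<open>The deterministic oracle inequality\<close>

lemma diag_form_entry:
  assumes "U \<in> carrier_mat N N" "r < N" "c < N"
  shows "(U * mat_diag N f * mat_adjoint U) $$ (r, c) = (\<Sum>l<N. U $$ (r, l) * f l * cnj (U $$ (c, l)))"
  using assms
  by (subst mat_times_entry[of _ N N _ N]) (auto simp: mat_diag_mult_right[of _ N N] intro!: sum.cong)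

text \<open>Each nonzero diagonal entry adds a matrix of rank one.\<close>

lemma rank_diag_form_le:
  fixes f :: "nat \<Rightarrow> complex"
  assumes U: "U \<in> carrier_mat N N" and T: "finite T" and f: "\<And>i. i < N \<Longrightarrow> i \<notin> T \<Longrightarrow> f i = 0"
  shows "vec_space.rank N (U * mat_diag N f * mat_adjoint U) \<le> card T"
  using T f
proof (induction T arbitrary: f rule: finite_induct)
  case empty
  then have "U * mat_diag N f * mat_adjoint U = 0\<^sub>m N N"
    using U by (intro eq_matI) (auto simp: diag_form_entry simp del: index_mult_mat(1))
  then show ?case by (simp add: vec_space.rank_0I)
next
  case (insert i T)
  let ?g = "f(i := 0)"
  let ?G = "U * mat_diag N ?g * mat_adjoint U"
  define M where "M = mat N N (\<lambda>(r, c). if i < N then (U $$ (r, i) * f i) * cnj (U $$ (c, i)) else 0)"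
  have cG: "?G \<in> carrier_mat N N" and M: "M \<in> carrier_mat N N"
    using U by (auto simp: M_def mult_carrier_mat[of _ N N _ N])
  have "U * mat_diag N f * mat_adjoint U = ?G + M"
  proof (rule eq_matI)
    fix r c assume "r < dim_row (?G + M)" "c < dim_col (?G + M)"
    then have rc: "r < N" "c < N" using M by auto
    have "(\<Sum>l<N. U $$ (r, l) * f l * cnj (U $$ (c, l)))
        = (\<Sum>l<N. U $$ (r, l) * ?g l * cnj (U $$ (c, l)) + (if l = i then (U $$ (r, i) * f i) * cnj (U $$ (c, i)) else 0))"
      by (intro sum.cong) auto
    also have "\<dots> = (\<Sum>l<N. U $$ (r, l) * ?g l * cnj (U $$ (c, l))) + M $$ (r, c)"
      using rc by (simp add: sum.distrib M_def)
    finally show "(U * mat_diag N f * mat_adjoint U) $$ (r, c) = (?G + M) $$ (r, c)"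
      using rc M cG by (simp add: diag_form_entry[OF U] del: index_mult_mat(1))
  qed (use U M in auto)
  then have "vec_space.rank N (U * mat_diag N f * mat_adjoint U) \<le> vec_space.rank N ?G + vec_space.rank N M"
    using vec_space.rank_subadditive[OF cG M] by simp
  also have "vec_space.rank N ?G \<le> card T"
    using insert by (intro insert.IH) auto
  also have "vec_space.rank N M \<le> 1"
    by (rule vec_space.rank_le_1_product_entries[OF M, of "\<lambda>r. if i < N then U $$ (r, i) * f i else 0" "\<lambda>c. cnj (U $$ (c, i))"])
      (auto simp: M_def)
  finally show ?case using insert by simp
qed

text \<open>Adding the projector onto the kernel makes the matrix invertible, and the rank of this projector
  is at most the number of vanishing eigenvalues; subadditivity of the rank then gives the lower
  bound.\<close>

lemma card_nonzero_eigenvalues_le_rank: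
  assumes A: "eigendecomp N U d A"
  shows "card {i. i < N \<and> d i \<noteq> 0} \<le> vec_space.rank N A"
proof -
  note U = eigendecompD[OF A]
  note ac = assoc_mult_mat[of _ N N _ N _ N] mult_carrier_mat[of _ N N _ N]
  \<comment> \<open>\<open>z\<close> selects the kernel and \<open>h\<close> is the spectrum after adding its projector.\<close>
  define z h where "z i = (if d i = 0 then 1 else 0 :: complex)" and "h i = complex_of_real (d i) + z i" for i
  let ?F = "\<lambda>f. U * mat_diag N f * mat_adjoint U"
  have cF: "?F f \<in> carrier_mat N N" for f using U(1) by (simp add: ac)
  have h0: "h i \<noteq> 0" for i by (simp add: h_def z_def)
  have AF: "?F h = A + ?F z"
    using U(1) U(4)
    by (intro eq_matI) (auto simp: diag_form_entry h_def algebra_simps sum.distrib simp del: index_mult_mat(1))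
  have "?F h * ?F (\<lambda>i. 1 / h i) = U * mat_diag N h * ((mat_adjoint U * U) * (mat_diag N (\<lambda>i. 1 / h i) * mat_adjoint U))"
    using U(1) by (simp add: ac)
  also have "\<dots> = U * (mat_diag N h * mat_diag N (\<lambda>i. 1 / h i)) * mat_adjoint U"
    unfolding U(2) using U(1) by (simp add: ac left_mult_one_mat[of _ N N] del: mat_diag_diag)
  also have "\<dots> = 1\<^sub>m N" using h0 U(1,3) by simp
  finally have "det (?F h) * det (?F (\<lambda>i. 1 / h i)) = 1"
    using det_mult[OF cF cF, of h "\<lambda>i. 1 / h i"] by simp
  then have "det (?F h) \<noteq> 0" by auto
  then have "vec_space.rank N (?F h) = N" using vec_space.det_rank_iff[OF cF] by blast
  then have "N \<le> vec_space.rank N A + vec_space.rank N (?F z)"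
    unfolding AF using vec_space.rank_subadditive[OF _ cF, of A z] U(1,4) cF by metis
  also have "vec_space.rank N (?F z) \<le> card {i. i < N \<and> d i = 0}"
    by (rule rank_diag_form_le[OF U(1)]) (auto simp: z_def)
  also have "card {i. i < N \<and> d i = 0} = N - card {i. i < N \<and> d i \<noteq> 0}"
  proof -
    have "{i. i < N \<and> d i = 0} = {..<N} - {i. i < N \<and> d i \<noteq> 0}" by auto
    then show ?thesis by (simp add: card_Diff_subset subset_iff)
  qed
  finally have "N \<le> vec_space.rank N A + (N - card {i. i < N \<and> d i \<noteq> 0})" by simp
  moreover have "card {i. i < N \<and> d i \<noteq> 0} \<le> N"
    using card_mono[of "{..<N}" "{i. i < N \<and> d i \<noteq> 0}"] by auto
  ultimately show ?thesis by linarith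
qed

lemma trace_pow_eigen:
  assumes A: "eigendecomp N U d A"
  shows "mat_trace (A ^\<^sub>m k) = complex_of_real (\<Sum>i<N. d i ^ k)"
proof -
  note U = eigendecompD[OF A]
  note ac = assoc_mult_mat[of _ N N _ N _ N] mult_carrier_mat[of _ N N _ N]
  let ?D = "mat_diag N (\<lambda>i. complex_of_real (d i ^ k))"
  have "mat_trace (A ^\<^sub>m k) = mat_trace (mat_adjoint U * (U * ?D))"
    unfolding eigendecomp_pow[OF A] using U(1) by (intro mat_trace_commute[of _ N]) (simp_all add: ac)
  also have "mat_adjoint U * (U * ?D) = (mat_adjoint U * U) * ?D" using U(1) by (simp add: ac)
  also have "\<dots> = ?D" unfolding U(2) by (simp add: left_mult_one_mat[of _ N N])
  finally show ?thesis by (simp add: mat_trace_carrier[of _ N N] mat_diag_def)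
qed

lemma frob_norm_sq_hermitian:
  assumes "hermitian_mat N A"
  shows "frob_norm_sq A = Re (mat_trace (A ^\<^sub>m 2))"
  using assms by (simp add: frob_norm_sq_def hermitian_mat_def numeral_2_eq_2 left_mult_one_mat[of _ N N])

text \<open>In the eigenbases of \<open>D\<close> and \<open>E\<close>, with eigenvalues \<open>d\<^sub>i\<close> and \<open>e\<^sub>j\<close>, the trace is an
  average of the products \<open>d\<^sub>i e\<^sub>j\<close> over \<open>j\<close>, summed over \<open>i\<close>. Young's inequality is applied to
  each product, and only nonzero \<open>d\<^sub>i\<close> contribute, which is how the rank of \<open>D\<close> enters. The
  hypothesis on the high power of \<open>E\<close> yields \<open>e\<^sub>j\<^sup>2 \<le> \<tau>\<close> for every \<open>j\<close>.\<close>

lemma trace_product_le: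
  assumes D: "hermitian_mat N D" and E: "hermitian_mat N E"
    and small: "Re (mat_trace (E ^\<^sub>m (2 * s))) < \<tau> ^ s" and \<tau>: "0 < \<tau>" and \<gamma>: "0 < \<gamma>"
  shows "2 * Re (mat_trace (D * E)) \<le> \<gamma> * \<tau> * real (vec_space.rank N D) + frob_norm_sq D / \<gamma>"
proof -
  obtain V d where V: "eigendecomp N V d D" using hermitian_eigendecomp[OF D] by auto
  obtain U e where U: "eigendecomp N U e E" using hermitian_eigendecomp[OF E] by auto
  have c: "D \<in> carrier_mat N N" "E \<in> carrier_mat N N" using D E by (auto simp: hermitian_mat_def)
  define G where "G = mat_adjoint V * U"
  have cG: "G \<in> carrier_mat N N" using eigendecompD(1)[OF U] eigendecompD(1)[OF V]
    by (simp add: G_def mult_carrier_mat[of _ N N _ N])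
  define g where "g i j = (cmod (G $$ (i, j)))\<^sup>2" for i j
  have e: "(e j)\<^sup>2 \<le> \<tau>" if "j < N" for j
  proof (rule ccontr)
    assume "\<not> (e j)\<^sup>2 \<le> \<tau>"
    then have "\<tau> ^ s \<le> ((e j)\<^sup>2) ^ s" using \<tau> by (intro power_mono) auto
    also have "\<dots> = e j ^ (2 * s)" by (simp add: power_mult)
    also have "\<dots> \<le> (\<Sum>i<N. e i ^ (2 * s))" using that by (intro member_le_sum) auto
    finally show False using small unfolding trace_pow_eigen[OF U] by simp
  qed
  have row: "(\<Sum>j<N. g i j) = 1" if i: "i < N" for i
  proof -
    have "G * mat_adjoint G = mat_adjoint V * ((U * mat_adjoint U) * V)"
      unfolding G_def using eigendecompD(1)[OF U] eigendecompD(1)[OF V]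
      by (simp add: mat_adjoint_mult_adjoint[of _ N] assoc_mult_mat[of _ N N _ N _ N] mult_carrier_mat[of _ N N _ N])
    also have "\<dots> = 1\<^sub>m N"
      unfolding eigendecompD(3)[OF U] using eigendecompD(1,2)[OF V] by (simp add: left_mult_one_mat[of _ N N])
    finally have "(G * mat_adjoint G) $$ (i, i) = 1" using i by simp
    also have "(G * mat_adjoint G) $$ (i, i) = (\<Sum>j<N. G $$ (i, j) * cnj (G $$ (i, j)))"
      using cG i by (subst mat_times_entry[of _ N N _ N]) auto
    also have "\<dots> = complex_of_real (\<Sum>j<N. g i j)"
      unfolding g_def of_real_sum by (intro sum.cong refl) (rule complex_norm_square[symmetric])
    finally show ?thesis by (metis of_real_eq_1_iff)
  qed
  have one_adj: "mat_adjoint (1\<^sub>m N) = (1\<^sub>m N :: complex mat)" by (intro eq_matI) auto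
  have "mat_trace (D * E) = complex_of_real (\<Sum>i<N. \<Sum>j<N. g i j * (d i * e j))"
    using trace_spectral[OF V U, of "1\<^sub>m N" 1 1] one_adj c eigendecompD(1)[OF U]
    by (simp add: g_def G_def left_mult_one_mat[of _ N N])
  then have "2 * Re (mat_trace (D * E)) = (\<Sum>i<N. \<Sum>j<N. g i j * (2 * (d i * e j)))"
    by (simp add: sum_distrib_left algebra_simps)
  also have "\<dots> \<le> (\<Sum>i<N. \<Sum>j<N. g i j * (\<gamma> * \<tau> * of_bool (d i \<noteq> 0) + (d i)\<^sup>2 / \<gamma>))"
  proof (intro sum_mono mult_left_mono)
    fix i j assume "i \<in> {..<N}" "j \<in> {..<N}"
    then have ej: "(e j)\<^sup>2 \<le> \<tau>" using e by simp
    show "2 * (d i * e j) \<le> \<gamma> * \<tau> * of_bool (d i \<noteq> 0) + (d i)\<^sup>2 / \<gamma>"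
    proof (cases "d i = 0")
      case False
      have "0 \<le> (\<gamma> * e j - d i)\<^sup>2 / \<gamma>" using \<gamma> by simp
      also have "\<dots> = \<gamma> * (e j)\<^sup>2 - 2 * (d i * e j) + (d i)\<^sup>2 / \<gamma>"
        using \<gamma> by (simp add: power2_diff field_simps power2_eq_square)
      finally have "2 * (d i * e j) \<le> \<gamma> * (e j)\<^sup>2 + (d i)\<^sup>2 / \<gamma>" by linarith
      also have "\<dots> \<le> \<gamma> * \<tau> + (d i)\<^sup>2 / \<gamma>" using ej \<gamma> by simp
      finally show ?thesis using False by simp
    qed simp
  qed (simp add: g_def)
  also have "\<dots> = (\<Sum>i<N. \<gamma> * \<tau> * of_bool (d i \<noteq> 0) + (d i)\<^sup>2 / \<gamma>)"
    by (intro sum.cong refl) (simp add: row sum_distrib_right[symmetric])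
  also have "\<dots> = \<gamma> * \<tau> * real (card {i. i < N \<and> d i \<noteq> 0}) + (\<Sum>i<N. (d i)\<^sup>2) / \<gamma>"
  proof -
    have "{..<N} \<inter> {i. d i \<noteq> 0} = {i. i < N \<and> d i \<noteq> 0}" by auto
    then show ?thesis by (simp add: sum.distrib sum_distrib_left[symmetric] sum_divide_distrib)
  qed
  also have "(\<Sum>i<N. (d i)\<^sup>2) = frob_norm_sq D"
    unfolding frob_norm_sq_hermitian[OF D] trace_pow_eigen[OF V] by simp
  also have "\<gamma> * \<tau> * real (card {i. i < N \<and> d i \<noteq> 0}) \<le> \<gamma> * \<tau> * real (vec_space.rank N D)"
    using \<gamma> \<tau> card_nonzero_eigenvalues_le_rank[OF V] by (intro mult_left_mono) auto
  finally show ?thesis by simp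
qed

lemma hermitian_minus:
  assumes "hermitian_mat N A" "hermitian_mat N B"
  shows "hermitian_mat N (A - B)"
proof -
  have c: "A \<in> carrier_mat N N" "B \<in> carrier_mat N N" using assms by (auto simp: hermitian_mat_def)
  have "mat_adjoint (A - B) = A - B"
  proof (rule eq_matI)
    fix k l assume "k < dim_row (A - B)" "l < dim_col (A - B)"
    then have kl: "k < N" "l < N" using c by auto
    show "mat_adjoint (A - B) $$ (k, l) = (A - B) $$ (k, l)"
      using c kl hermitian_entry[OF assms(1), of l k] hermitian_entry[OF assms(2), of l k] by simp
  qed (use c in auto)
  then show ?thesis using c by (auto simp: hermitian_mat_def)
qed

lemma frob_norm_sq_expand:
  assumes S: "S \<in> carrier_mat N N" and A: "hermitian_mat N A" and B: "hermitian_mat N B"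
  shows "frob_norm_sq (S - A) = frob_norm_sq (S - B) - 2 * Re (mat_trace ((S - B) * (A - B))) + frob_norm_sq (A - B)"
proof -
  have c: "A \<in> carrier_mat N N" "B \<in> carrier_mat N N" using A B by (auto simp: hermitian_mat_def)
  have E: "hermitian_mat N (A - B)" by (rule hermitian_minus[OF A B])
  have "(cmod ((S - A) $$ (k, l)))\<^sup>2 = (cmod ((S - B) $$ (k, l)))\<^sup>2
      - 2 * Re ((S - B) $$ (k, l) * (A - B) $$ (l, k)) + (cmod ((A - B) $$ (k, l)))\<^sup>2" if "k < N" "l < N" for k l
  proof -
    have "(cmod (x - y))\<^sup>2 = (cmod x)\<^sup>2 - 2 * Re (x * cnj y) + (cmod y)\<^sup>2" for x y :: complex
      unfolding cmod_power2 by (simp add: power2_eq_square algebra_simps)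
    moreover have "(S - A) $$ (k, l) = (S - B) $$ (k, l) - (A - B) $$ (k, l)"
      using that S c by simp
    ultimately show ?thesis unfolding hermitian_entry[OF E that] by simp
  qed
  moreover have "S - A \<in> carrier_mat N N" "S - B \<in> carrier_mat N N" "A - B \<in> carrier_mat N N"
    using c by (auto intro: minus_carrier_mat)
  moreover from this have "mat_trace ((S - B) * (A - B)) = (\<Sum>l<N. \<Sum>k<N. (S - B) $$ (k, l) * (A - B) $$ (l, k))"
    unfolding mat_trace_times[OF \<open>S - B \<in> carrier_mat N N\<close> \<open>A - B \<in> carrier_mat N N\<close>] by (intro sum.swap)
  ultimately show ?thesis
    by (simp add: frob_norm_sq_entries[of _ N N] sum_distrib_left sum.distrib sum_subtractf
      del: index_minus_mat)
qed

lemma frob_norm_sq_weighted_triangle: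
  assumes S: "S \<in> carrier_mat N N" and A: "A \<in> carrier_mat N N" and B: "B \<in> carrier_mat N N" and t: "0 < t"
  shows "frob_norm_sq (S - A) \<le> (1 + t) * frob_norm_sq (S - B) + (1 + 1 / t) * frob_norm_sq (A - B)"
proof -
  have "(cmod (x - y))\<^sup>2 \<le> (1 + t) * (cmod x)\<^sup>2 + (1 + 1 / t) * (cmod y)\<^sup>2" for x y :: complex
  proof -
    have "(cmod (x - y))\<^sup>2 \<le> (cmod x + cmod y)\<^sup>2"
      by (intro power_mono norm_triangle_ineq4) auto
    also have "\<dots> = (1 + t) * (cmod x)\<^sup>2 + (1 + 1 / t) * (cmod y)\<^sup>2 - (t * cmod x - cmod y)\<^sup>2 / t"
      using t by (simp add: power2_eq_square field_simps)
    also have "\<dots> \<le> (1 + t) * (cmod x)\<^sup>2 + (1 + 1 / t) * (cmod y)\<^sup>2" using t by simp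
    finally show ?thesis .
  qed
  moreover have "(S - A) $$ (k, l) = (S - B) $$ (k, l) - (A - B) $$ (k, l)" if "k < N" "l < N" for k l
    using that S A B by simp
  ultimately have "(cmod ((S - A) $$ (k, l)))\<^sup>2 \<le> (1 + t) * (cmod ((S - B) $$ (k, l)))\<^sup>2
      + (1 + 1 / t) * (cmod ((A - B) $$ (k, l)))\<^sup>2" if "k < N" "l < N" for k l
    using that by metis
  then have "(\<Sum>l<N. \<Sum>k<N. (cmod ((S - A) $$ (k, l)))\<^sup>2)
    \<le> (\<Sum>l<N. \<Sum>k<N. (1 + t) * (cmod ((S - B) $$ (k, l)))\<^sup>2 + (1 + 1 / t) * (cmod ((A - B) $$ (k, l)))\<^sup>2)"
    by (intro sum_mono) simp
  moreover have "S - A \<in> carrier_mat N N" "S - B \<in> carrier_mat N N" "A - B \<in> carrier_mat N N"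
    using A B by (auto intro: minus_carrier_mat)
  ultimately show ?thesis
    by (simp add: frob_norm_sq_entries[of _ N N] sum_distrib_left sum.distrib del: index_minus_mat)
qed

text \<open>The competitor \<open>R\<close> keeps the first \<open>k\<close> eigenvalues of \<open>\<rho>\<close>. Comparing its criterion
  with that of \<open>S\<close> and expanding both squares around \<open>\<rho>\<close> leaves \<open>2 tr ((S - R) E)\<close>.
  Young's inequality with parameter \<open>1 + \<theta>\<close> makes the rank of \<open>S\<close> cancel
  against its penalty, and the constants of the weighted triangle inequality are tuned so
  that the fraction of \<open>\<parallel>S - \<rho>\<parallel>\<^sup>2\<close> that remains on the left is exactly \<open>1 / c(\<theta>)\<close>.\<close>

theorem oracle_inequality:
  assumes \<rho>: "hermitian_mat N \<rho>" and U: "eigendecomp N U \<mu> \<rho>" and A: "hermitian_mat N A"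
    and S: "rank_penalized_minimizer N \<nu> A S"
    and small: "Re (mat_trace ((A - \<rho>) ^\<^sub>m (2 * s))) < \<tau> ^ s" and \<tau>: "0 < \<tau>"
    and \<theta>: "0 < \<theta>" and \<nu>: "(1 + \<theta>) * \<tau> \<le> \<nu>" and k: "k \<le> N"
  shows "frob_norm_sq (S - \<rho>)
    \<le> (oracle_const \<theta>)\<^sup>2 * (\<Sum>i\<in>{k..<N}. (\<mu> i)\<^sup>2) + 2 * oracle_const \<theta> * \<nu> * real k"
proof -
  note cU = eigendecompD[OF U]
  define c where "c = oracle_const \<theta>"
  define f where "f i = (if i < k then complex_of_real (\<mu> i) else 0)" for i
  define R where "R = U * mat_diag N f * mat_adjoint U"
  note ac = assoc_mult_mat[of _ N N _ N _ N] mult_carrier_mat[of _ N N _ N]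
  have R: "R \<in> carrier_mat N N" using cU(1) by (simp add: R_def ac)
  have hR: "hermitian_mat N R"
  proof -
    have "mat_adjoint (mat_diag N f) = mat_diag N f" by (intro eq_matI) (auto simp: mat_diag_def f_def)
    then have "mat_adjoint R = R" unfolding R_def using cU(1) by (simp add: mat_adjoint_mult_adjoint[of _ N] ac)
    then show ?thesis using R by (simp add: hermitian_mat_def)
  qed
  have hS: "hermitian_mat N S" and crit: "rank_criterion N \<nu> A S \<le> rank_criterion N \<nu> A R"
    using S hR by (auto simp: rank_penalized_minimizer_def is_arg_min_def not_less)
  have cc: "S \<in> carrier_mat N N" "A \<in> carrier_mat N N" "\<rho> \<in> carrier_mat N N"
    using hS A \<rho> by (auto simp: hermitian_mat_def)
  have rR: "vec_space.rank N R \<le> k"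
    unfolding R_def using rank_diag_form_le[OF cU(1), of "{..<k}" f] by (simp add: f_def)
  define x where "x = frob_norm_sq (S - \<rho>)"
  define y where "y = frob_norm_sq (R - \<rho>)"
  have y: "y = (\<Sum>i\<in>{k..<N}. (\<mu> i)\<^sup>2)"
  proof -
    define q where "q i = (if i < k then 0 else - \<mu> i)" for i
    have "R - \<rho> = U * mat_diag N (\<lambda>i. complex_of_real (q i)) * mat_adjoint U"
    proof (rule eq_matI)
      let ?Q = "U * mat_diag N (\<lambda>i. complex_of_real (q i)) * mat_adjoint U"
      fix r l assume "r < dim_row ?Q" "l < dim_col ?Q"
      then have rl: "r < N" "l < N" using cU(1) by auto
      have "(R - \<rho>) $$ (r, l) = (\<Sum>i<N. U $$ (r, i) * f i * cnj (U $$ (l, i)))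
         - (\<Sum>i<N. U $$ (r, i) * complex_of_real (\<mu> i) * cnj (U $$ (l, i)))"
        unfolding R_def using rl cc cU(1)
        by (subst cU(4)) (simp add: diag_form_entry del: index_mult_mat(1))
      also have "\<dots> = ?Q $$ (r, l)"
        unfolding diag_form_entry[OF cU(1) rl] sum_subtractf[symmetric]
        by (intro sum.cong) (auto simp: f_def q_def algebra_simps)
      finally show "(R - \<rho>) $$ (r, l) = ?Q $$ (r, l)" .
    qed (use cU(1) R cc in auto)
    then have "eigendecomp N U q (R - \<rho>)" using cU(1,2) by (simp add: eigendecomp_def)
    then have "y = (\<Sum>i<N. (q i)\<^sup>2)"
      unfolding y_def frob_norm_sq_hermitian[OF hermitian_minus[OF hR \<rho>]] by (simp add: trace_pow_eigen)
    also have "\<dots> = (\<Sum>i\<in>{k..<N}. (\<mu> i)\<^sup>2)"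
      by (rule sum.mono_neutral_cong_right) (auto simp: q_def)
    finally show ?thesis .
  qed
  let ?E = "A - \<rho>"
  have hE: "hermitian_mat N ?E" and hD: "hermitian_mat N (S - R)"
    using hermitian_minus A \<rho> hS hR by auto
  have "x \<le> y + 2 * (Re (mat_trace ((S - \<rho>) * ?E)) - Re (mat_trace ((R - \<rho>) * ?E)))
      + \<nu> * (real (vec_space.rank N R) - real (vec_space.rank N S))"
    using crit frob_norm_sq_expand[OF cc(1) A \<rho>] frob_norm_sq_expand[OF R A \<rho>]
    by (simp add: rank_criterion_def x_def y_def algebra_simps)
  also have "Re (mat_trace ((S - \<rho>) * ?E)) - Re (mat_trace ((R - \<rho>) * ?E)) = Re (mat_trace ((S - R) * ?E))"
  proof -
    have "S - \<rho> = (S - R) + (R - \<rho>)" using cc R by (intro eq_matI) auto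
    moreover have "((S - R) + (R - \<rho>)) * ?E = (S - R) * ?E + (R - \<rho>) * ?E"
      using cc R by (intro add_mult_distrib_mat[of _ N N _ _ N]) auto
    moreover have "mat_trace ((S - R) * ?E + (R - \<rho>) * ?E) = mat_trace ((S - R) * ?E) + mat_trace ((R - \<rho>) * ?E)"
      using cc R by (intro mat_trace_add[of _ N]) (auto intro!: mult_carrier_mat[of _ N N _ N])
    ultimately show ?thesis by simp
  qed
  also have "2 * Re (mat_trace ((S - R) * ?E))
      \<le> (1 + \<theta>) * \<tau> * real (vec_space.rank N (S - R)) + frob_norm_sq (S - R) / (1 + \<theta>)"
    by (rule trace_product_le[OF hD hE small \<tau>]) (use \<theta> in auto)
  finally have main: "x \<le> y + ((1 + \<theta>) * \<tau> * real (vec_space.rank N (S - R)) + frob_norm_sq (S - R) / (1 + \<theta>))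
      + \<nu> * (real (vec_space.rank N R) - real (vec_space.rank N S))" by simp
  have rD: "vec_space.rank N (S - R) \<le> vec_space.rank N S + k"
  proof -
    let ?R = "U * mat_diag N (\<lambda>i. - f i) * mat_adjoint U"
    have cR: "?R \<in> carrier_mat N N" using cU(1) by (simp add: ac)
    have "S - R = S + ?R"
      using cc cU(1) R by (intro eq_matI)
        (auto simp: R_def diag_form_entry sum_negf simp del: index_mult_mat(1))
    then have "vec_space.rank N (S - R) \<le> vec_space.rank N S + vec_space.rank N ?R"
      using vec_space.rank_subadditive[OF cc(1) cR] by simp
    also have "vec_space.rank N ?R \<le> k"
      using rank_diag_form_le[OF cU(1), of "{..<k}" "\<lambda>i. - f i"] by (simp add: f_def)
    finally show ?thesis by simp
  qed
  have \<nu>0: "0 \<le> (1 + \<theta>) * \<tau>" using \<theta> \<tau> by simp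
  have "(1 + \<theta>) * \<tau> * real (vec_space.rank N (S - R)) \<le> (1 + \<theta>) * \<tau> * (real (vec_space.rank N S) + real k)"
    using rD \<nu>0 by (intro mult_left_mono) auto
  also have "\<dots> \<le> \<nu> * (real (vec_space.rank N S) + real k)" using \<nu> by (intro mult_right_mono) auto
  finally have p1: "(1 + \<theta>) * \<tau> * real (vec_space.rank N (S - R)) \<le> \<nu> * (real (vec_space.rank N S) + real k)" .
  have p2: "\<nu> * (real (vec_space.rank N R) - real (vec_space.rank N S)) \<le> \<nu> * (real k - real (vec_space.rank N S))"
    using rR \<nu> \<nu>0 by (intro mult_left_mono) auto
  have p3: "frob_norm_sq (S - R) / (1 + \<theta>) \<le> 2 / (2 + \<theta>) * x + 2 / \<theta> * y"
  proof -
    \<comment> \<open>With this weight, dividing by \<open>1 + \<theta>\<close> leaves the coefficients \<open>2 / (2 + \<theta>)\<close> and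
      \<open>2 / \<theta>\<close>; the first is \<open>1 - 1 / c(\<theta>)\<close> and the second is \<open>c(\<theta>) - 1\<close>.\<close>
    let ?t = "\<theta> / (2 + \<theta>)"
    have "frob_norm_sq (S - R) \<le> (1 + ?t) * x + (1 + 1 / ?t) * y"
      unfolding x_def y_def using \<theta> by (intro frob_norm_sq_weighted_triangle[OF cc(1) R cc(3)]) auto
    then have "frob_norm_sq (S - R) / (1 + \<theta>) \<le> ((1 + ?t) * x + (1 + 1 / ?t) * y) / (1 + \<theta>)"
      using \<theta> by (intro divide_right_mono) auto
    also have "\<dots> = (1 + ?t) / (1 + \<theta>) * x + (1 + 1 / ?t) / (1 + \<theta>) * y"
    proof -
      have "(u * x + v * y) / w = u / w * x + v / w * y" for u v w :: real by (simp add: add_divide_distrib)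
      then show ?thesis .
    qed
    also have "(1 + ?t) / (1 + \<theta>) = 2 / (2 + \<theta>)"
      using \<theta> by (simp add: divide_simps)
    also have "(1 + 1 / ?t) / (1 + \<theta>) = 2 / \<theta>" using \<theta> by (simp add: divide_simps)
    finally show ?thesis .
  qed
  have "x \<le> y + \<nu> * (real (vec_space.rank N S) + real k) + (2 / (2 + \<theta>) * x + 2 / \<theta> * y)
     + \<nu> * (real k - real (vec_space.rank N S))"
    using main p1 p2 p3 by linarith
  then have "x - 2 / (2 + \<theta>) * x \<le> c * y + 2 * \<nu> * real k"
    by (simp add: c_def oracle_const_def algebra_simps)
  moreover have "x - 2 / (2 + \<theta>) * x = x / c"
    using \<theta> by (simp add: c_def oracle_const_def divide_simps) (simp add: algebra_simps)
  moreover have "c > 0" using \<theta> by (simp add: c_def oracle_const_def add_pos_pos)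
  ultimately have "x \<le> (c * y + 2 * \<nu> * real k) * c" by (simp add: pos_divide_le_eq)
  then show ?thesis unfolding x_def[symmetric] y[symmetric] c_def[symmetric]
    by (simp add: power2_eq_square algebra_simps)
qed

section \<open>Pauli measurements as qubitwise tensor products\<close>

lemma sum_lists_Suc:
  "(\<Sum>xs | set xs \<subseteq> T \<and> length xs = Suc n. f xs)
    = (\<Sum>x\<in>T. \<Sum>xs | set xs \<subseteq> T \<and> length xs = n. f (x # xs))"
proof -
  have "(\<Sum>xs | set xs \<subseteq> T \<and> length xs = Suc n. f xs)
      = (\<Sum>(xs, x)\<in>{xs. set xs \<subseteq> T \<and> length xs = n} \<times> T. f (x # xs))"
    unfolding lists_length_Suc_eq by (subst sum.reindex) (auto simp: inj_on_def split_beta)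
  then show ?thesis by (simp add: sum.cartesian_product[symmetric] sum.swap[of _ T])
qed

lemma settings_alt: "settings n = {xs. set xs \<subseteq> {PX, PY, PZ} \<and> length xs = n}"
  by (auto simp: settings_def)

lemma outcomes_alt: "outcomes n = {xs. set xs \<subseteq> {- 1, 1} \<and> length xs = n}"
  by (auto simp: outcomes_def)

lemma pauli_words_alt: "pauli_words n = {xs. set xs \<subseteq> {PI, PX, PY, PZ} \<and> length xs = n}"
proof -
  have "x \<in> {PI, PX, PY, PZ}" for x by (cases x) auto
  then show ?thesis by (auto simp: pauli_words_def subset_iff)
qed

lemma sum_settings_Suc: "(\<Sum>a\<in>settings (Suc n). f a) = (\<Sum>x\<in>{PX, PY, PZ}. \<Sum>a\<in>settings n. f (x # a))"
  unfolding settings_alt by (rule sum_lists_Suc)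

lemma sum_outcomes_Suc: "(\<Sum>r\<in>outcomes (Suc n). f r) = (\<Sum>x\<in>{- 1, 1}. \<Sum>r\<in>outcomes n. f (x # r))"
  unfolding outcomes_alt by (rule sum_lists_Suc)

lemma sum_pauli_words_Suc:
  "(\<Sum>b\<in>pauli_words (Suc n). f b) = (\<Sum>x\<in>{PI, PX, PY, PZ}. \<Sum>b\<in>pauli_words n. f (x # b))"
  unfolding pauli_words_alt by (rule sum_lists_Suc)

lemma finite_settings [simp]: "finite (settings n)"
  unfolding settings_alt by (rule finite_lists_length_eq) simp

lemma finite_outcomes [simp]: "finite (outcomes n)"
  unfolding outcomes_alt by (rule finite_lists_length_eq) simp

lemma card_settings: "card (settings n) = 3 ^ n"
proof -
  have "card {PX, PY, PZ} = 3" by simp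
  then show ?thesis unfolding settings_alt by (subst card_lists_length_eq) (simp_all del: card_insert_disjoint)
qed

lemma settings_SucE:
  assumes "a \<in> settings (Suc n)"
  obtains x a' where "a = x # a'" "x \<in> {PX, PY, PZ}" "a' \<in> settings n"
  using assms by (cases a) (auto simp: settings_def)

lemma outcomes_SucE:
  assumes "r \<in> outcomes (Suc n)"
  obtains x r' where "r = x # r'" "x \<in> {- 1, 1}" "r' \<in> outcomes n"
  using assms by (cases r) (auto simp: outcomes_def)

lemma sum_div_mod: "(\<Sum>i<p * q. f i) = (\<Sum>i<p. \<Sum>j<q. f (i * q + j))" for f :: "nat \<Rightarrow> 'a :: comm_monoid_add"
proof -
  have "(\<Sum>j = i * q..<i * q + q. f j) = (\<Sum>j<q. f (i * q + j))" for i
    using sum.shift_bounds_nat_ivl[of f 0 "i * q" q] by (simp add: lessThan_atLeast0 add.commute)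
  then show ?thesis using sum.nat_group[of f q p] by simp
qed

lemma kron_carrier [simp]:
  "A \<in> carrier_mat p p \<Longrightarrow> B \<in> carrier_mat q q \<Longrightarrow> kron A B \<in> carrier_mat (p * q) (p * q)"
  by (auto simp: kron_def)

lemma kron_entry:
  assumes "A \<in> carrier_mat p p" "B \<in> carrier_mat q q" "i < p * q" "j < p * q"
  shows "kron A B $$ (i, j) = A $$ (i div q, j div q) * B $$ (i mod q, j mod q)"
  using assms by (auto simp: kron_def)

lemma div_less_of_less_times: "i < p * q \<Longrightarrow> i div q < (p :: nat)"
  by (simp add: less_mult_imp_div_less)

lemma mod_less_of_less_times: "i < p * q \<Longrightarrow> i mod q < (q :: nat)"
  by (cases "q = 0") auto

lemma hermitian_kron:
  assumes A: "hermitian_mat p A" and B: "hermitian_mat q B"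
  shows "hermitian_mat (p * q) (kron A B)"
proof -
  have c: "A \<in> carrier_mat p p" "B \<in> carrier_mat q q" using A B by (auto simp: hermitian_mat_def)
  have hA: "cnj (A $$ (j, i)) = A $$ (i, j)" if "i < p" "j < p" for i j
    using hermitian_entry[OF A, of j i] that by simp
  have hB: "cnj (B $$ (j, i)) = B $$ (i, j)" if "i < q" "j < q" for i j
    using hermitian_entry[OF B, of j i] that by simp
  have "mat_adjoint (kron A B) = kron A B"
  proof (rule eq_matI)
    fix i j assume "i < dim_row (kron A B)" "j < dim_col (kron A B)"
    then have ij: "i < p * q" "j < p * q" using kron_carrier[OF c] by auto
    then show "mat_adjoint (kron A B) $$ (i, j) = kron A B $$ (i, j)"
      using kron_carrier[OF c]
      by (simp add: kron_entry[OF c] hA hB div_less_of_less_times mod_less_of_less_times)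
  qed (use kron_carrier[OF c] in auto)
  then show ?thesis using kron_carrier[OF c] by (simp add: hermitian_mat_def)
qed

lemma op_norm_sq_le_kron:
  assumes cA: "A \<in> carrier_mat p p" and cB: "B \<in> carrier_mat q q"
    and A: "op_norm_sq_le p A C" and B: "op_norm_sq_le q B D" and C: "0 \<le> C"
  shows "op_norm_sq_le (p * q) (kron A B) (C * D)"
  unfolding op_norm_sq_le_def
proof
  fix v :: "nat \<Rightarrow> complex"
  define u where "u j i = (\<Sum>l<q. B $$ (i, l) * v (j * q + l))" for j i
  have idx: "i * q + k < p * q" if "i < p" "k < q" for i k
  proof -
    have "i * q + k < Suc i * q" using that by simp
    also have "\<dots> \<le> p * q" using that by (intro mult_right_mono) auto
    finally show ?thesis .
  qed
  have ent: "(\<Sum>j<p * q. kron A B $$ (i * q + k, j) * v j) = (\<Sum>j<p. A $$ (i, j) * u j k)"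
    if "i < p" "k < q" for i k
    unfolding sum_div_mod u_def sum_distrib_left
    using that by (intro sum.cong refl) (auto simp: kron_entry[OF cA cB] idx mult.assoc)
  have "(\<Sum>i<p * q. (cmod (\<Sum>j<p * q. kron A B $$ (i, j) * v j))\<^sup>2)
      = (\<Sum>i<p. \<Sum>k<q. (cmod (\<Sum>j<p. A $$ (i, j) * u j k))\<^sup>2)"
    by (subst sum_div_mod) (intro sum.cong refl, simp add: ent)
  also have "\<dots> = (\<Sum>k<q. \<Sum>i<p. (cmod (\<Sum>j<p. A $$ (i, j) * u j k))\<^sup>2)" by (rule sum.swap)
  also have "\<dots> \<le> (\<Sum>k<q. C * (\<Sum>j<p. (cmod (u j k))\<^sup>2))"
    using A by (intro sum_mono) (auto simp: op_norm_sq_le_def)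
  also have "\<dots> = C * (\<Sum>j<p. \<Sum>k<q. (cmod (u j k))\<^sup>2)"
    unfolding sum_distrib_left[symmetric] by (subst sum.swap) simp
  also have "\<dots> \<le> C * (\<Sum>j<p. D * (\<Sum>l<q. (cmod (v (j * q + l)))\<^sup>2))"
    using B C unfolding u_def by (intro mult_left_mono sum_mono) (auto simp: op_norm_sq_le_def)
  also have "\<dots> = C * D * (\<Sum>j<p * q. (cmod (v j))\<^sup>2)"
    unfolding sum_div_mod by (simp add: sum_distrib_left mult.assoc)
  finally show "(\<Sum>i<p * q. (cmod (\<Sum>j<p * q. kron A B $$ (i, j) * v j))\<^sup>2) \<le> C * D * (\<Sum>j<p * q. (cmod (v j))\<^sup>2)" .
qed

lemma pauli_mat_carrier [simp]: "pauli_mat x \<in> carrier_mat 2 2"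
  by (cases x) (auto simp: mat_of_rows_list_def)

lemma pauli_mat_dim [simp]: "dim_row (pauli_mat x) = 2" "dim_col (pauli_mat x) = 2"
  using carrier_matD[OF pauli_mat_carrier[of x]] by simp_all

text \<open>The one-qubit inverse of the measurement channel, applied to the observed projector and divided
  by the number three of settings.\<close>

definition local_snapshot :: "pauli \<Rightarrow> int \<Rightarrow> complex mat" where
  "local_snapshot a r = (1 / 2 :: complex) \<cdot>\<^sub>m ((1 / 3 :: complex) \<cdot>\<^sub>m 1\<^sub>m 2 + of_int r \<cdot>\<^sub>m pauli_mat a)"

lemma local_snapshot_carrier [simp]: "local_snapshot a r \<in> carrier_mat 2 2"
  by (simp add: local_snapshot_def)

text \<open>The contribution of one measured outcome to the linear estimator, up to the average over the
  repetitions; see \<open>lin_estimator_snapshot\<close>.\<close>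

definition snapshot :: "pauli list \<Rightarrow> int list \<Rightarrow> complex mat" where
  "snapshot a r = kron_list (map2 local_snapshot a r)"

lemma snapshot_Cons: "snapshot (x # a) (y # r) = kron (local_snapshot x y) (snapshot a r)"
  by (simp add: snapshot_def kron_list_def)

lemma snapshot_Nil: "snapshot [] [] = 1\<^sub>m 1"
  by (simp add: snapshot_def kron_list_def)

lemma snapshot_carrier:
  "a \<in> settings n \<Longrightarrow> r \<in> outcomes n \<Longrightarrow> snapshot a r \<in> carrier_mat (2 ^ n) (2 ^ n)"
proof (induction n arbitrary: a r)
  case 0
  then show ?case by (simp add: settings_def outcomes_def snapshot_Nil)
next
  case (Suc n)
  then show ?case
    by (elim settings_SucE outcomes_SucE) (auto simp: snapshot_Cons intro!: kron_carrier)
qed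

lemma pauli_tensor_carrier [simp]: "length b = n \<Longrightarrow> pauli_tensor b \<in> carrier_mat (2 ^ n) (2 ^ n)"
proof (induction b arbitrary: n)
  case Nil
  then show ?case by (simp add: pauli_tensor_def kron_list_def)
next
  case (Cons x b)
  then show ?case
    by (cases n) (auto simp: pauli_tensor_def kron_list_def intro!: kron_carrier)
qed

lemma pauli_proj_carrier [simp]:
  "a \<in> {PX, PY, PZ} \<Longrightarrow> r \<in> {- 1, 1} \<Longrightarrow> pauli_proj a r \<in> carrier_mat 2 2"
  unfolding pauli_proj_eq by simp

lemma outcome_proj_carrier:
  "a \<in> settings n \<Longrightarrow> r \<in> outcomes n \<Longrightarrow> outcome_proj a r \<in> carrier_mat (2 ^ n) (2 ^ n)"
proof (induction n arbitrary: a r)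
  case 0
  then show ?case by (simp add: settings_def outcomes_def outcome_proj_def kron_list_def)
next
  case (Suc n)
  obtain x a' where a: "a = x # a'" "x \<in> {PX, PY, PZ}" "a' \<in> settings n"
    using Suc.prems(1) by (rule settings_SucE)
  obtain y r' where r: "r = y # r'" "y \<in> {- 1, 1}" "r' \<in> outcomes n"
    using Suc.prems(2) by (rule outcomes_SucE)
  have "kron (pauli_proj x y) (outcome_proj a' r') \<in> carrier_mat (2 * 2 ^ n) (2 * 2 ^ n)"
    by (intro kron_carrier pauli_proj_carrier a r Suc.IH)
  then show ?case using a r by (simp add: outcome_proj_def kron_list_def)
qed

lemma less_2_split: "(i :: nat) < 2 \<longleftrightarrow> i = 0 \<or> i = 1" by auto

text \<open>The left-hand side is an entry of \<open>(1 \<otimes> 1 + \<Sum>\<^sub>a \<sigma>\<^sub>a \<otimes> \<sigma>\<^sub>a) / 2\<close>, the operator that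
  swaps two qubits: in the sum over \<open>r = \<plusminus>1\<close> the terms linear in \<open>r\<close> cancel.\<close>

lemma local_swap:
  assumes "k < 2" "l < 2" "x < 2" "y < 2"
  shows "(\<Sum>a\<in>{PX, PY, PZ}. \<Sum>r\<in>{- 1, 1}. pauli_proj a r $$ (l, k) * local_snapshot a r $$ (x, y))
    = of_bool (k = x \<and> l = y)"
  using assms unfolding less_2_split
  by (auto simp: pauli_proj_eq local_snapshot_def mat_of_rows_list_def)

lemma local_pauli_expansion:
  assumes "k < 2" "l < 2" "a \<in> {PX, PY, PZ}"
  shows "local_snapshot a r $$ (k, l)
    = (\<Sum>x\<in>{PI, PX, PY, PZ}. complex_of_real (1 / 2 * (if x = PI then 1 / 3 else real_of_int r * of_bool (a = x))) * pauli_mat x $$ (k, l))"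
  using assms unfolding less_2_split
  by (auto simp: local_snapshot_def mat_of_rows_list_def)

lemma hermitian_local_snapshot:
  assumes "a \<in> {PX, PY, PZ}"
  shows "hermitian_mat 2 (local_snapshot a r)"
proof -
  have "mat_adjoint (local_snapshot a r) = local_snapshot a r"
    using assms by (intro eq_matI) (auto simp: local_snapshot_def mat_of_rows_list_def less_2_split)
  then show ?thesis by (simp add: hermitian_mat_def)
qed

text \<open>The eigenvalues are \<open>2/3\<close> and \<open>-1/3\<close>. Explicitly, the deficit is a multiple of
  \<open>\<parallel>v - r \<sigma>\<^sub>a v\<parallel>\<^sup>2\<close>.\<close>

lemma op_norm_local_snapshot:
  assumes a: "a \<in> {PX, PY, PZ}" and r: "r \<in> {- 1, 1}"
  shows "op_norm_sq_le 2 (local_snapshot a r) (4 / 9)"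
  unfolding op_norm_sq_le_def
proof
  fix v :: "nat \<Rightarrow> complex"
  let ?S = "\<lambda>i. \<Sum>j<2. pauli_mat a $$ (i, j) * v j"
  have "4 / 9 * (\<Sum>j<2. (cmod (v j))\<^sup>2) - (\<Sum>i<2. (cmod (\<Sum>j<2. local_snapshot a r $$ (i, j) * v j))\<^sup>2)
      = 1 / 12 * (\<Sum>i<2. (cmod (v i - of_int r * ?S i))\<^sup>2)"
    using a r unfolding cmod_power2
    by (auto simp: local_snapshot_def mat_of_rows_list_def numeral_2_eq_2 power2_eq_square field_simps)
  moreover have "0 \<le> 1 / 12 * (\<Sum>i<2. (cmod (v i - of_int r * ?S i))\<^sup>2)"
    by (intro mult_nonneg_nonneg sum_nonneg) auto
  ultimately show "(\<Sum>i<2. (cmod (\<Sum>j<2. local_snapshot a r $$ (i, j) * v j))\<^sup>2) \<le> 4 / 9 * (\<Sum>j<2. (cmod (v j))\<^sup>2)"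
    by linarith
qed

lemma hermitian_snapshot:
  "a \<in> settings n \<Longrightarrow> r \<in> outcomes n \<Longrightarrow> hermitian_mat (2 ^ n) (snapshot a r)"
proof (induction n arbitrary: a r)
  case 0
  have "mat_adjoint (1\<^sub>m 1) = (1\<^sub>m 1 :: complex mat)" by (intro eq_matI) auto
  then show ?case using 0 by (simp add: settings_def outcomes_def snapshot_Nil hermitian_mat_def)
next
  case (Suc n)
  obtain x a' where a: "a = x # a'" "x \<in> {PX, PY, PZ}" "a' \<in> settings n"
    using Suc.prems(1) by (rule settings_SucE)
  obtain y r' where r: "r = y # r'" "y \<in> {- 1, 1}" "r' \<in> outcomes n"
    using Suc.prems(2) by (rule outcomes_SucE)
  have "hermitian_mat (2 * 2 ^ n) (kron (local_snapshot x y) (snapshot a' r'))"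
    by (intro hermitian_kron hermitian_local_snapshot a r Suc.IH)
  then show ?case using a r by (simp add: snapshot_Cons)
qed

lemma op_norm_snapshot:
  "a \<in> settings n \<Longrightarrow> r \<in> outcomes n \<Longrightarrow> op_norm_sq_le (2 ^ n) (snapshot a r) ((4 / 9) ^ n)"
proof (induction n arbitrary: a r)
  case 0
  then show ?case by (simp add: settings_def outcomes_def snapshot_Nil op_norm_sq_le_def)
next
  case (Suc n)
  obtain x a' where a: "a = x # a'" "x \<in> {PX, PY, PZ}" "a' \<in> settings n"
    using Suc.prems(1) by (rule settings_SucE)
  obtain y r' where r: "r = y # r'" "y \<in> {- 1, 1}" "r' \<in> outcomes n"
    using Suc.prems(2) by (rule outcomes_SucE)
  have "op_norm_sq_le (2 * 2 ^ n) (kron (local_snapshot x y) (snapshot a' r')) (4 / 9 * (4 / 9) ^ n)"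
    by (intro op_norm_sq_le_kron op_norm_local_snapshot snapshot_carrier a r Suc.IH) auto
  then show ?case using a r by (simp add: snapshot_Cons)
qed

text \<open>The swap of two systems of \<open>n\<close> qubits is the tensor product of the one-qubit swaps: quotient
  and remainder of the indices modulo \<open>2^n\<close> separate the first qubit from the others.\<close>

lemma snapshot_swap:
  assumes "k < 2 ^ n" "l < 2 ^ n" "x < 2 ^ n" "y < 2 ^ n"
  shows "(\<Sum>a\<in>settings n. \<Sum>r\<in>outcomes n. outcome_proj a r $$ (l, k) * snapshot a r $$ (x, y))
    = of_bool (k = x \<and> l = y)"
  using assms
proof (induction n arbitrary: k l x y)
  case 0
  have "settings 0 = {[]}" "outcomes 0 = {[]}" by (auto simp: settings_def outcomes_def)
  then show ?case using 0 by (simp add: snapshot_Nil outcome_proj_def kron_list_def)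
next
  case (Suc n)
  let ?q = "2 ^ n :: nat"
  have lt: "k < 2 * ?q" "l < 2 * ?q" "x < 2 * ?q" "y < 2 * ?q" using Suc.prems by auto
  note dm = lt[THEN div_less_of_less_times] lt[THEN mod_less_of_less_times]
  let ?P = "\<lambda>a0 r0. pauli_proj a0 r0 $$ (l div ?q, k div ?q) * local_snapshot a0 r0 $$ (x div ?q, y div ?q)"
  let ?Q = "\<lambda>a r. outcome_proj a r $$ (l mod ?q, k mod ?q) * snapshot a r $$ (x mod ?q, y mod ?q)"
  have fact: "outcome_proj (a0 # a) (r0 # r) $$ (l, k) * snapshot (a0 # a) (r0 # r) $$ (x, y) = ?P a0 r0 * ?Q a r"
    if "a0 \<in> {PX, PY, PZ}" "r0 \<in> {- 1, 1}" "a \<in> settings n" "r \<in> outcomes n" for a0 r0 a r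
  proof -
    have "outcome_proj (a0 # a) (r0 # r) = kron (pauli_proj a0 r0) (outcome_proj a r)"
      by (simp add: outcome_proj_def kron_list_def)
    then show ?thesis unfolding snapshot_Cons
      using kron_entry[OF pauli_proj_carrier[OF that(1,2)] outcome_proj_carrier[OF that(3,4)] lt(2,1)]
        kron_entry[OF local_snapshot_carrier[of a0 r0] snapshot_carrier[OF that(3,4)] lt(3,4)]
      by (simp add: mult_ac)
  qed
  have "(\<Sum>a\<in>settings (Suc n). \<Sum>r\<in>outcomes (Suc n). outcome_proj a r $$ (l, k) * snapshot a r $$ (x, y))
      = (\<Sum>a0\<in>{PX, PY, PZ}. \<Sum>a\<in>settings n. \<Sum>r0\<in>{- 1, 1}. \<Sum>r\<in>outcomes n. ?P a0 r0 * ?Q a r)"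
    unfolding sum_settings_Suc sum_outcomes_Suc by (intro sum.cong refl fact)
  also have "\<dots> = (\<Sum>a0\<in>{PX, PY, PZ}. \<Sum>r0\<in>{- 1, 1}. ?P a0 r0) * (\<Sum>a\<in>settings n. \<Sum>r\<in>outcomes n. ?Q a r)"
    unfolding sum_distrib_right
    unfolding sum_distrib_left by (intro sum.cong refl sum.swap)
  also have "(\<Sum>a0\<in>{PX, PY, PZ}. \<Sum>r0\<in>{- 1, 1}. ?P a0 r0) = of_bool (k div ?q = x div ?q \<and> l div ?q = y div ?q)"
    by (rule local_swap) (use dm in auto)
  also have "(\<Sum>a\<in>settings n. \<Sum>r\<in>outcomes n. ?Q a r) = of_bool (k mod ?q = x mod ?q \<and> l mod ?q = y mod ?q)"
    by (rule Suc.IH) (use dm in auto)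
  also have "of_bool (k div ?q = x div ?q \<and> l div ?q = y div ?q) * of_bool (k mod ?q = x mod ?q \<and> l mod ?q = y mod ?q)
      = (of_bool (k = x \<and> l = y) :: complex)"
  proof -
    have eq: "i = j \<longleftrightarrow> i div ?q = j div ?q \<and> i mod ?q = j mod ?q" for i j :: nat
      by (metis div_mult_mod_eq)
    have "k = x \<and> l = y \<longleftrightarrow> (k div ?q = x div ?q \<and> l div ?q = y div ?q) \<and> (k mod ?q = x mod ?q \<and> l mod ?q = y mod ?q)"
      using eq[of k x] eq[of l y] by argo
    then show ?thesis by (simp only: of_bool_conj)
  qed
  finally show ?case .
qed

lemma design_coeff_alt:
  "design_coeff r a b = (\<Prod>j<length b. if b ! j = PI then 1 else real_of_int (r ! j) * of_bool (a ! j = b ! j))"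
  unfolding design_coeff_def
  by (rule prod.mono_neutral_cong_left) (auto simp: identity_positions_def)

lemma design_coeff_Cons:
  "design_coeff (r0 # r) (a0 # a) (x # b) = (if x = PI then 1 else real_of_int r0 * of_bool (a0 = x)) * design_coeff r a b"
  unfolding design_coeff_alt length_Cons prod.lessThan_Suc_shift nth_Cons_0 nth_Cons_Suc by (rule refl)

lemma card_identity_positions: "card (identity_positions b) = (\<Sum>j<length b. of_bool (b ! j = PI))"
proof -
  have "identity_positions b = {..<length b} \<inter> {j. b ! j = PI}" by (auto simp: identity_positions_def)
  then show ?thesis by simp
qed

lemma card_identity_positions_Cons:
  "card (identity_positions (x # b)) = of_bool (x = PI) + card (identity_positions b)"
  unfolding card_identity_positions length_Cons sum.lessThan_Suc_shift nth_Cons_0 nth_Cons_Suc by (rule refl)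

text \<open>Multiplying out the tensor product of the sums \<open>1/3 + r\<^sub>j \<sigma>\<^bsub>a\<^sub>j\<^esub>\<close> gives one term for each
  Pauli word; the identity positions collect the factors \<open>1/3\<close>, the other positions the signs.\<close>

lemma snapshot_pauli_expansion:
  assumes "a \<in> settings n" "r \<in> outcomes n" "k < 2 ^ n" "l < 2 ^ n"
  shows "snapshot a r $$ (k, l) = (\<Sum>b\<in>pauli_words n.
    complex_of_real (1 / (3 ^ card (identity_positions b) * 2 ^ n) * design_coeff r a b) * pauli_tensor b $$ (k, l))"
  using assms
proof (induction n arbitrary: a r k l)
  case 0
  have "pauli_words 0 = {[]}" by (auto simp: pauli_words_def)
  then show ?case using 0
    by (simp add: settings_def outcomes_def snapshot_Nil pauli_tensor_def kron_list_def design_coeff_def identity_positions_def)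
next
  case (Suc n)
  obtain a0 a' where a: "a = a0 # a'" "a0 \<in> {PX, PY, PZ}" "a' \<in> settings n"
    using Suc.prems(1) by (rule settings_SucE)
  obtain r0 r' where r: "r = r0 # r'" "r0 \<in> {- 1, 1}" "r' \<in> outcomes n"
    using Suc.prems(2) by (rule outcomes_SucE)
  let ?q = "2 ^ n :: nat"
  have lt: "k < 2 * ?q" "l < 2 * ?q" using Suc.prems by auto
  note dm = lt[THEN div_less_of_less_times] lt[THEN mod_less_of_less_times]
  have "snapshot a r $$ (k, l) = local_snapshot a0 r0 $$ (k div ?q, l div ?q) * snapshot a' r' $$ (k mod ?q, l mod ?q)"
    unfolding a(1) r(1) snapshot_Cons
    by (rule kron_entry[OF local_snapshot_carrier snapshot_carrier[OF a(3) r(3)] lt])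
  also have "\<dots> = (\<Sum>x\<in>{PI, PX, PY, PZ}. complex_of_real (1 / 2 * (if x = PI then 1 / 3 else real_of_int r0 * of_bool (a0 = x))) * pauli_mat x $$ (k div ?q, l div ?q))
      * (\<Sum>b\<in>pauli_words n. complex_of_real (1 / (3 ^ card (identity_positions b) * 2 ^ n) * design_coeff r' a' b) * pauli_tensor b $$ (k mod ?q, l mod ?q))"
    using local_pauli_expansion[OF dm(1,2) a(2)] Suc.IH[OF a(3) r(3) dm(3,4)] by simp
  also have "\<dots> = (\<Sum>b\<in>pauli_words (Suc n). complex_of_real (1 / (3 ^ card (identity_positions b) * 2 ^ Suc n) * design_coeff r a b) * pauli_tensor b $$ (k, l))"
    unfolding sum_pauli_words_Suc sum_product
  proof (intro sum.cong refl)
    fix x b assume b: "b \<in> pauli_words n"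
    then have "pauli_tensor b \<in> carrier_mat ?q ?q" by (simp add: pauli_words_def)
    from kron_entry[OF pauli_mat_carrier[of x] this lt]
    have "pauli_tensor (x # b) $$ (k, l) = pauli_mat x $$ (k div ?q, l div ?q) * pauli_tensor b $$ (k mod ?q, l mod ?q)"
      by (simp add: pauli_tensor_def kron_list_def)
    then show "complex_of_real (1 / 2 * (if x = PI then 1 / 3 else real_of_int r0 * of_bool (a0 = x))) * pauli_mat x $$ (k div ?q, l div ?q)
        * (complex_of_real (1 / (3 ^ card (identity_positions b) * 2 ^ n) * design_coeff r' a' b) * pauli_tensor b $$ (k mod ?q, l mod ?q))
      = complex_of_real (1 / (3 ^ card (identity_positions (x # b)) * 2 ^ Suc n) * design_coeff r a (x # b)) * pauli_tensor (x # b) $$ (k, l)"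
      unfolding a(1) r(1) design_coeff_Cons card_identity_positions_Cons
      by (cases "x = PI") (simp_all add: field_simps)
  qed
  finally show ?case .
qed

lemma lin_estimator_snapshot:
  assumes D: "\<And>a i. a \<in> settings n \<Longrightarrow> i \<in> {1..m} \<Longrightarrow> D a i \<in> outcomes n" and kl: "k < 2 ^ n" "l < 2 ^ n"
  shows "lin_estimator n m D $$ (k, l)
    = complex_of_real (1 / real m) * (\<Sum>a\<in>settings n. \<Sum>i = 1..m. snapshot a (D a i) $$ (k, l))"
proof -
  define w where "w b = 1 / (3 ^ card (identity_positions b) * 2 ^ n :: real)" for b
  have coeff: "lin_est_coeff n m D b = (1 / real m) * (\<Sum>a\<in>settings n. \<Sum>i = 1..m. w b * design_coeff (D a i) a b)" for b
  proof -
    have "(\<Sum>(r, a)\<in>outcomes n \<times> settings n. emp_freq m D r a * design_coeff r a b)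
        = (\<Sum>a\<in>settings n. \<Sum>r\<in>outcomes n. emp_freq m D r a * design_coeff r a b)"
      unfolding sum.cartesian_product[symmetric] by (rule sum.swap)
    also have "\<dots> = (\<Sum>a\<in>settings n. \<Sum>r\<in>outcomes n. \<Sum>i = 1..m. (1 / real m) * (if D a i = r then design_coeff r a b else 0))"
      unfolding emp_freq_def sum_distrib_left sum_distrib_right by (intro sum.cong refl) auto
    also have "\<dots> = (\<Sum>a\<in>settings n. \<Sum>i = 1..m. \<Sum>r\<in>outcomes n. (1 / real m) * (if D a i = r then design_coeff r a b else 0))"
      by (intro sum.cong refl sum.swap)
    also have "\<dots> = (\<Sum>a\<in>settings n. \<Sum>i = 1..m. (1 / real m) * design_coeff (D a i) a b)"
      unfolding sum_distrib_left[symmetric] using D by (intro sum.cong refl arg_cong2[where f = "(*)"]) simp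
    finally have e: "(\<Sum>(r, a)\<in>outcomes n \<times> settings n. emp_freq m D r a * design_coeff r a b)
        = (\<Sum>a\<in>settings n. \<Sum>i = 1..m. (1 / real m) * design_coeff (D a i) a b)" .
    show ?thesis unfolding lin_est_coeff_def w_def e sum_distrib_left by (intro sum.cong refl) simp
  qed
  have "lin_estimator n m D $$ (k, l) = (\<Sum>b\<in>pauli_words n. \<Sum>a\<in>settings n. \<Sum>i = 1..m.
      complex_of_real (1 / real m) * (complex_of_real (w b * design_coeff (D a i) a b) * pauli_tensor b $$ (k, l)))"
    using kl by (simp add: lin_estimator_def coeff sum_distrib_left sum_distrib_right mult.assoc)
  also have "\<dots> = (\<Sum>a\<in>settings n. \<Sum>i = 1..m. \<Sum>b\<in>pauli_words n.
      complex_of_real (1 / real m) * (complex_of_real (w b * design_coeff (D a i) a b) * pauli_tensor b $$ (k, l)))"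
    by (subst sum.swap, subst (2) sum.swap) simp
  also have "\<dots> = (\<Sum>a\<in>settings n. \<Sum>i = 1..m. complex_of_real (1 / real m) * snapshot a (D a i) $$ (k, l))"
    using D kl by (intro sum.cong refl) (simp add: snapshot_pauli_expansion w_def sum_distrib_left)
  finally show ?thesis by (simp add: sum_distrib_left)
qed

section \<open>Centering, and the law of finite-valued independent data\<close>

text \<open>Jensen's inequality, from the nonnegativity of the variance of the moduli.\<close>

lemma weighted_mean_square_le:
  fixes z :: "'x \<Rightarrow> complex" and p :: "'x \<Rightarrow> real"
  assumes p: "\<And>x. x \<in> \<Omega> \<Longrightarrow> 0 \<le> p x" and s: "(\<Sum>x\<in>\<Omega>. p x) = 1"
  shows "(cmod (\<Sum>x\<in>\<Omega>. complex_of_real (p x) * z x))\<^sup>2 \<le> (\<Sum>x\<in>\<Omega>. p x * (cmod (z x))\<^sup>2)"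
proof -
  define c where "c = (\<Sum>x\<in>\<Omega>. p x * cmod (z x))"
  have "cmod (\<Sum>x\<in>\<Omega>. complex_of_real (p x) * z x) \<le> c"
    unfolding c_def using p by (intro order_trans[OF norm_sum] sum_mono) (simp add: norm_mult)
  then have "(cmod (\<Sum>x\<in>\<Omega>. complex_of_real (p x) * z x))\<^sup>2 \<le> c\<^sup>2" by (intro power_mono) auto
  also have "c\<^sup>2 \<le> (\<Sum>x\<in>\<Omega>. p x * (cmod (z x))\<^sup>2)"
  proof -
    have "0 \<le> (\<Sum>x\<in>\<Omega>. p x * (cmod (z x) - c)\<^sup>2)" using p by (intro sum_nonneg) auto
    also have "\<dots> = (\<Sum>x\<in>\<Omega>. p x * (cmod (z x))\<^sup>2 - 2 * c * (p x * cmod (z x)) + c\<^sup>2 * p x)"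
      by (intro sum.cong refl) (simp add: power2_diff algebra_simps)
    also have "\<dots> = (\<Sum>x\<in>\<Omega>. p x * (cmod (z x))\<^sup>2) - 2 * c * c + c\<^sup>2"
      unfolding sum.distrib sum_subtractf sum_distrib_left[symmetric] s c_def[symmetric] by simp
    finally show ?thesis by (simp add: power2_eq_square)
  qed
  finally show ?thesis .
qed

definition centered_mat :: "nat \<Rightarrow> 'x set \<Rightarrow> ('x \<Rightarrow> real) \<Rightarrow> real \<Rightarrow> ('x \<Rightarrow> complex mat) \<Rightarrow> 'x \<Rightarrow> complex mat" where
  "centered_mat N \<Omega> p c W x = mat N N (\<lambda>(k, l).
     complex_of_real c * (W x $$ (k, l) - (\<Sum>y\<in>\<Omega>. complex_of_real (p y) * W y $$ (k, l))))"

lemma hermitian_centered_mat: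
  assumes W: "\<And>x. x \<in> \<Omega> \<Longrightarrow> hermitian_mat N (W x)" and x: "x \<in> \<Omega>"
  shows "hermitian_mat N (centered_mat N \<Omega> p c W x)"
proof -
  have "cnj (W y $$ (l, k)) = W y $$ (k, l)" if "y \<in> \<Omega>" "k < N" "l < N" for y k l
    using hermitian_entry[OF W[OF that(1)] that(3,2)] by simp
  then have "mat_adjoint (centered_mat N \<Omega> p c W x) = centered_mat N \<Omega> p c W x"
    using x by (intro eq_matI) (auto simp: centered_mat_def intro!: sum.cong)
  then show ?thesis by (simp add: hermitian_mat_def centered_mat_def)
qed

lemma centered_mat_mean:
  assumes "(\<Sum>x\<in>\<Omega>. p x) = 1" "k < N" "l < N"
  shows "(\<Sum>x\<in>\<Omega>. complex_of_real (p x) * centered_mat N \<Omega> p c W x $$ (k, l)) = 0"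
proof -
  define \<mu> where "\<mu> = (\<Sum>y\<in>\<Omega>. complex_of_real (p y) * W y $$ (k, l))"
  have "(\<Sum>x\<in>\<Omega>. complex_of_real (p x) * centered_mat N \<Omega> p c W x $$ (k, l))
      = (\<Sum>x\<in>\<Omega>. complex_of_real c * (complex_of_real (p x) * W x $$ (k, l)) - complex_of_real (p x) * (complex_of_real c * \<mu>))"
    using assms(2,3) by (intro sum.cong refl) (simp add: centered_mat_def \<mu>_def[symmetric] algebra_simps)
  also have "\<dots> = complex_of_real c * \<mu> - complex_of_real (\<Sum>x\<in>\<Omega>. p x) * (complex_of_real c * \<mu>)"
    by (simp only: sum_subtractf sum_distrib_left[symmetric] sum_distrib_right[symmetric] of_real_sum \<mu>_def[symmetric])
  finally show ?thesis using assms(1) by simp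
qed

text \<open>The factor four comes from \<open>|x - y|\<^sup>2 \<le> 2 |x|\<^sup>2 + 2 |y|\<^sup>2\<close>, with Jensen's inequality for the mean.\<close>

lemma op_norm_centered_mat:
  assumes p: "\<And>x. x \<in> \<Omega> \<Longrightarrow> 0 \<le> p x" and s: "(\<Sum>x\<in>\<Omega>. p x) = 1"
    and W: "\<And>x. x \<in> \<Omega> \<Longrightarrow> op_norm_sq_le N (W x) K" and x: "x \<in> \<Omega>"
  shows "op_norm_sq_le N (centered_mat N \<Omega> p c W x) (c\<^sup>2 * (4 * K))"
  unfolding op_norm_sq_le_def
proof
  fix v :: "nat \<Rightarrow> complex"
  define z where "z y i = (\<Sum>j<N. W y $$ (i, j) * v j)" for y i
  let ?V = "\<Sum>j<N. (cmod (v j))\<^sup>2"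
  have zK: "(\<Sum>i<N. (cmod (z y i))\<^sup>2) \<le> K * ?V" if "y \<in> \<Omega>" for y
    using W[OF that] by (simp add: op_norm_sq_le_def z_def)
  have ent: "(\<Sum>j<N. centered_mat N \<Omega> p c W x $$ (i, j) * v j)
      = complex_of_real c * (z x i - (\<Sum>y\<in>\<Omega>. complex_of_real (p y) * z y i))" if "i < N" for i
  proof -
    have "(\<Sum>j<N. centered_mat N \<Omega> p c W x $$ (i, j) * v j)
        = (\<Sum>j<N. complex_of_real c * (W x $$ (i, j) * v j - (\<Sum>y\<in>\<Omega>. complex_of_real (p y) * (W y $$ (i, j) * v j))))"
      using that by (intro sum.cong refl) (simp add: centered_mat_def left_diff_distrib sum_distrib_right mult.assoc)
    also have "\<dots> = complex_of_real c * (z x i - (\<Sum>j<N. \<Sum>y\<in>\<Omega>. complex_of_real (p y) * (W y $$ (i, j) * v j)))"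
      unfolding z_def by (simp only: sum_distrib_left[symmetric] sum_subtractf)
    also have "(\<Sum>j<N. \<Sum>y\<in>\<Omega>. complex_of_real (p y) * (W y $$ (i, j) * v j)) = (\<Sum>y\<in>\<Omega>. complex_of_real (p y) * z y i)"
      unfolding z_def sum_distrib_left by (rule sum.swap)
    finally show ?thesis .
  qed
  have pt: "(cmod (\<Sum>j<N. centered_mat N \<Omega> p c W x $$ (i, j) * v j))\<^sup>2
      \<le> c\<^sup>2 * (2 * (cmod (z x i))\<^sup>2 + 2 * (\<Sum>y\<in>\<Omega>. p y * (cmod (z y i))\<^sup>2))" if i: "i < N" for i
  proof -
    let ?b = "\<Sum>y\<in>\<Omega>. complex_of_real (p y) * z y i"
    have "(cmod (z x i - ?b))\<^sup>2 \<le> (cmod (z x i) + cmod ?b)\<^sup>2"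
      by (intro power_mono norm_triangle_ineq4) auto
    also have "\<dots> \<le> 2 * (cmod (z x i))\<^sup>2 + 2 * (cmod ?b)\<^sup>2"
      using sum_squares_bound[of "cmod (z x i)" "cmod ?b"] by (simp add: power2_sum)
    also have "\<dots> \<le> 2 * (cmod (z x i))\<^sup>2 + 2 * (\<Sum>y\<in>\<Omega>. p y * (cmod (z y i))\<^sup>2)"
      using weighted_mean_square_le[OF p s, of "\<lambda>y. z y i"] by simp
    finally show ?thesis
      unfolding ent[OF i] by (simp add: norm_mult power_mult_distrib mult_left_mono)
  qed
  have "(\<Sum>i<N. (cmod (\<Sum>j<N. centered_mat N \<Omega> p c W x $$ (i, j) * v j))\<^sup>2)
      \<le> (\<Sum>i<N. c\<^sup>2 * (2 * (cmod (z x i))\<^sup>2 + 2 * (\<Sum>y\<in>\<Omega>. p y * (cmod (z y i))\<^sup>2)))"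
    by (intro sum_mono pt) auto
  also have "\<dots> = c\<^sup>2 * (2 * (\<Sum>i<N. (cmod (z x i))\<^sup>2) + 2 * (\<Sum>i<N. \<Sum>y\<in>\<Omega>. p y * (cmod (z y i))\<^sup>2))"
    by (simp only: sum_distrib_left[symmetric] sum.distrib)
  also have "(\<Sum>i<N. \<Sum>y\<in>\<Omega>. p y * (cmod (z y i))\<^sup>2) = (\<Sum>y\<in>\<Omega>. p y * (\<Sum>i<N. (cmod (z y i))\<^sup>2))"
    unfolding sum_distrib_left by (rule sum.swap)
  also have "c\<^sup>2 * (2 * (\<Sum>i<N. (cmod (z x i))\<^sup>2) + 2 * \<dots>) \<le> c\<^sup>2 * (2 * (K * ?V) + 2 * (\<Sum>y\<in>\<Omega>. p y * (K * ?V)))"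
    using p x by (intro mult_left_mono add_mono sum_mono zK) auto
  also have "\<dots> = c\<^sup>2 * (4 * K) * ?V"
    unfolding sum_distrib_right[symmetric] s by simp
  finally show "(\<Sum>i<N. (cmod (\<Sum>j<N. centered_mat N \<Omega> p c W x $$ (i, j) * v j))\<^sup>2) \<le> c\<^sup>2 * (4 * K) * ?V" .
qed


text \<open>Every event expressed by the data is a finite disjoint union of events that fix all
  coordinates, and is therefore measurable for an arbitrary predicate \<open>Q\<close>; this matters because
  the event of interest quantifies over all minimizers.\<close>

lemma indep_vars_finite_law:
  assumes M: "prob_space M" and ind: "prob_space.indep_vars M (\<lambda>_. count_space \<Omega>) Z I"
    and I: "finite I" "I \<noteq> {}" and \<Omega>: "finite \<Omega>"
  shows "measure M {\<omega> \<in> space M. Q (\<lambda>i\<in>I. Z i \<omega>)}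
    = (\<Sum>d | d \<in> I \<rightarrow>\<^sub>E \<Omega> \<and> Q d. \<Prod>i\<in>I. measure M {\<omega> \<in> space M. Z i \<omega> = d i})"
proof -
  interpret prob_space M by fact
  have meas: "Z i \<in> measurable M (count_space \<Omega>)" if "i \<in> I" for i
    using ind that by (simp add: indep_vars_def)
  let ?A = "\<lambda>d. {\<omega> \<in> space M. (\<lambda>i\<in>I. Z i \<omega>) = d}"
  let ?G = "{d \<in> I \<rightarrow>\<^sub>E \<Omega>. Q d}"
  have fin: "finite ?G" using I \<Omega> by (simp add: finite_PiE)
  have vimage: "Z i -` {x} \<inter> space M = {\<omega> \<in> space M. Z i \<omega> = x}" for i x by auto
  have Int: "?A d = (\<Inter>i\<in>I. Z i -` {d i} \<inter> space M)" if "d \<in> I \<rightarrow>\<^sub>E \<Omega>" for d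
    using I that by (auto simp: fun_eq_iff PiE_iff extensional_def)
  have ev: "?A d \<in> events" if "d \<in> I \<rightarrow>\<^sub>E \<Omega>" for d
    unfolding Int[OF that] using I that meas by (intro sets.finite_INT measurable_sets) (auto simp: PiE_iff)
  have point: "prob (?A d) = (\<Prod>i\<in>I. prob {\<omega> \<in> space M. Z i \<omega> = d i})" if d: "d \<in> I \<rightarrow>\<^sub>E \<Omega>" for d
  proof -
    have "prob (\<Inter>i\<in>I. Z i -` {d i} \<inter> space M) = (\<Prod>i\<in>I. prob (Z i -` {d i} \<inter> space M))"
      by (rule indep_varsD_finite[OF ind]) (use I d in \<open>auto simp: PiE_iff\<close>)
    then show ?thesis unfolding Int[OF d] vimage by simp
  qed
  have "{\<omega> \<in> space M. Q (\<lambda>i\<in>I. Z i \<omega>)} = (\<Union>d\<in>?G. ?A d)"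
    using measurable_space[OF meas] by auto
  then have "prob {\<omega> \<in> space M. Q (\<lambda>i\<in>I. Z i \<omega>)} = (\<Sum>d\<in>?G. prob (?A d))"
    using ev fin by (simp only:) (intro finite_measure_finite_Union, auto simp: disjoint_family_on_def)
  then show ?thesis using point by simp
qed

lemma prob_finite_valued_sum:
  assumes M: "prob_space M" and Z: "Z \<in> measurable M (count_space \<Omega>)" and \<Omega>: "finite \<Omega>"
  shows "(\<Sum>x\<in>\<Omega>. measure M {\<omega> \<in> space M. Z \<omega> = x}) = 1"
proof -
  interpret prob_space M by fact
  have ev: "{\<omega> \<in> space M. Z \<omega> = x} \<in> events" if "x \<in> \<Omega>" for x
  proof -
    have "Z -` {x} \<inter> space M \<in> events" using that by (intro measurable_sets[OF Z]) auto
    also have "Z -` {x} \<inter> space M = {\<omega> \<in> space M. Z \<omega> = x}" by auto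
    finally show ?thesis .
  qed
  have "(\<Sum>x\<in>\<Omega>. prob {\<omega> \<in> space M. Z \<omega> = x}) = prob (\<Union>x\<in>\<Omega>. {\<omega> \<in> space M. Z \<omega> = x})"
    using ev \<Omega> by (intro finite_measure_finite_Union[symmetric]) (auto simp: disjoint_family_on_def)
  also have "(\<Union>x\<in>\<Omega>. {\<omega> \<in> space M. Z \<omega> = x}) = space M"
    using measurable_space[OF Z] by auto
  finally show ?thesis using prob_space by simp
qed

text \<open>Contracting \<open>\<rho>\<close> with the swap operator returns \<open>\<rho>\<close>.\<close>

lemma snapshot_unbiased:
  assumes \<rho>: "\<rho> \<in> carrier_mat (2 ^ n) (2 ^ n)" and kl: "k < 2 ^ n" "l < 2 ^ n"
  shows "(\<Sum>a\<in>settings n. \<Sum>r\<in>outcomes n. mat_trace (\<rho> * outcome_proj a r) * snapshot a r $$ (k, l)) = \<rho> $$ (k, l)"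
proof -
  let ?N = "2 ^ n :: nat"
  have "(\<Sum>a\<in>settings n. \<Sum>r\<in>outcomes n. mat_trace (\<rho> * outcome_proj a r) * snapshot a r $$ (k, l))
      = (\<Sum>a\<in>settings n. \<Sum>r\<in>outcomes n. \<Sum>x<?N. \<Sum>y<?N. \<rho> $$ (x, y) * (outcome_proj a r $$ (y, x) * snapshot a r $$ (k, l)))"
    by (intro sum.cong refl)
      (simp add: mat_trace_times[OF \<rho> outcome_proj_carrier] sum_distrib_right mult.assoc)
  also have "\<dots> = (\<Sum>a\<in>settings n. \<Sum>x<?N. \<Sum>y<?N. \<Sum>r\<in>outcomes n. \<rho> $$ (x, y) * (outcome_proj a r $$ (y, x) * snapshot a r $$ (k, l)))"
    by (rule sum.cong[OF refl], subst sum.swap, rule sum.cong[OF refl], rule sum.swap)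
  also have "\<dots> = (\<Sum>x<?N. \<Sum>y<?N. \<Sum>a\<in>settings n. \<Sum>r\<in>outcomes n. \<rho> $$ (x, y) * (outcome_proj a r $$ (y, x) * snapshot a r $$ (k, l)))"
    by (subst sum.swap, rule sum.cong[OF refl], rule sum.swap)
  also have "\<dots> = (\<Sum>x<?N. \<Sum>y<?N. \<rho> $$ (x, y) * of_bool (x = k \<and> y = l))"
    unfolding sum_distrib_left[symmetric] using kl by (intro sum.cong refl) (simp add: snapshot_swap)
  also have "\<dots> = (\<Sum>x<?N. if x = k then \<rho> $$ (x, l) else 0)"
    using kl by (intro sum.cong refl) (simp add: of_bool_def if_distrib cong: if_cong)
  also have "\<dots> = \<rho> $$ (k, l)" using kl by simp
  finally show ?thesis .
qed

lemma lin_estimator_cong: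
  assumes "\<And>a i. a \<in> settings n \<Longrightarrow> i \<in> {1..m} \<Longrightarrow> D a i = D' a i"
  shows "lin_estimator n m D = lin_estimator n m D'"
proof -
  have "emp_freq m D r a = emp_freq m D' r a" if "a \<in> settings n" for r a
    unfolding emp_freq_def using assms[OF that] by (intro arg_cong2[where f = "(*)"] refl sum.cong) simp
  then have "lin_est_coeff n m D b = lin_est_coeff n m D' b" for b
    unfolding lin_est_coeff_def by (intro arg_cong2[where f = "(*)"] refl sum.cong) auto
  then show ?thesis by (simp add: lin_estimator_def)
qed

lemma hermitian_of_minus:
  assumes A: "A \<in> carrier_mat N N" and B: "hermitian_mat N B" and AB: "hermitian_mat N (A - B)"
  shows "hermitian_mat N A"
proof -
  have cB: "B \<in> carrier_mat N N" using B by (simp add: hermitian_mat_def)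
  have "mat_adjoint A = A"
  proof (rule eq_matI)
    fix k l assume "k < dim_row A" "l < dim_col A"
    then have kl: "k < N" "l < N" using A by auto
    have "cnj ((A - B) $$ (l, k)) = (A - B) $$ (k, l)" "cnj (B $$ (l, k)) = B $$ (k, l)"
      using hermitian_entry[OF AB kl(2,1)] hermitian_entry[OF B kl(2,1)] by auto
    then show "mat_adjoint A $$ (k, l) = A $$ (k, l)" using A cB kl by auto
  qed (use A in auto)
  then show ?thesis using A by (simp add: hermitian_mat_def)
qed

text \<open>Since \<open>L \<ge> ln 2 \<ge> 2/3\<close>, the base \<open>s / (8 L)\<close> is at most \<open>(L + 1) / (8 L) \<le> 5/16\<close>, which is
  below \<open>1/e\<close>; and \<open>exp (- s) \<le> exp (- L) = \<epsilon> / 2^n\<close>.\<close>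

lemma tail_constant_less:
  fixes L :: real
  assumes n: "1 \<le> n" and \<epsilon>: "0 < \<epsilon>" "\<epsilon> < 1" and L: "L = real n * ln 2 - ln \<epsilon>"
  defines "s \<equiv> nat \<lceil>L\<rceil>"
  shows "2 ^ n * (real s / (8 * L)) ^ s < \<epsilon>"
proof -
  have "ln 2 \<le> real n * ln 2" using n by simp
  moreover have "ln \<epsilon> < 0" using \<epsilon> by simp
  ultimately have L23: "2 / 3 \<le> L" unfolding L using ln2_ge_two_thirds by linarith
  then have s: "real s \<le> L + 1" "L \<le> real s" "1 \<le> s" unfolding s_def by linarith+
  have "real s / (8 * L) \<le> 5 / 16" using s(1) L23 by (simp add: field_simps)
  moreover have "5 / 16 < exp (- 1 :: real)"
    using e_less_272 by (simp add: exp_minus field_simps)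
  ultimately have "(real s / (8 * L)) ^ s < exp (- 1) ^ s"
    using s(3) L23 by (intro power_strict_mono) auto
  also have "\<dots> = exp (- real s)" by (simp add: exp_of_nat_mult[symmetric])
  also have "\<dots> \<le> exp (- L)" using s(2) by simp
  also have "\<dots> = \<epsilon> / 2 ^ n"
    unfolding L using \<epsilon> by (simp add: exp_diff exp_of_nat_mult)
  finally show ?thesis by (simp add: field_simps)
qed

section \<open>The oracle inequality with high probability\<close>

theorem corollary5:
  fixes n m :: nat and \<rho> :: "complex mat" and lam :: "nat \<Rightarrow> real"
    and M :: "'w measure" and R :: "pauli list \<Rightarrow> nat \<Rightarrow> 'w \<Rightarrow> int list"
    and \<theta> \<epsilon> :: real
  assumes "n \<ge> 1" and "m \<ge> 1"
    and "density_matrix (2 ^ n) \<rho>"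
    and "ordered_eigenvalues (2 ^ n) \<rho> lam"
    and "prob_space M"
    and "prob_space.indep_vars M (\<lambda>_. count_space (outcomes n)) (\<lambda>(a, i). R a i)
           (settings n \<times> {1..m})"
    and "\<And>a i r. a \<in> settings n \<Longrightarrow> i \<in> {1..m} \<Longrightarrow> r \<in> outcomes n \<Longrightarrow>
           complex_of_real (measure M {\<omega> \<in> space M. R a i \<omega> = r})
             = mat_trace (\<rho> * outcome_proj a r)"
    and "\<theta> > 0" and "0 < \<epsilon>" and "\<epsilon> < 1"
  shows "measure M {\<omega> \<in> space M. \<forall>S.
           rank_penalized_minimizer (2 ^ n) (nu_choice n m \<theta> \<epsilon>)
             (lin_estimator n m (\<lambda>a i. R a i \<omega>)) S \<longrightarrow>
           frob_norm_sq (S - \<rho>) \<le>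
             Min ((\<lambda>k. (oracle_const \<theta>)\<^sup>2 * (\<Sum>j\<in>{k<..2 ^ n}. (lam j)\<^sup>2)
                        + 2 * oracle_const \<theta> * nu_choice n m \<theta> \<epsilon> * real k) ` {1..2 ^ n})}
         > 1 - \<epsilon>"
proof -
  let ?N = "2 ^ n :: nat"
  let ?I = "settings n \<times> {1..m}"
  let ?\<Omega> = "outcomes n"
  interpret prob_space M by fact
  \<comment> \<open>Data are indexed by the pairs of a setting and a repetition; \<open>X\<close> is the contribution of such a
    pair to the estimation error.\<close>
  define p where "p ai r = measure M {\<omega> \<in> space M. (case ai of (a, i) \<Rightarrow> R a i) \<omega> = r}" for ai r
  define X where "X ai = centered_mat ?N ?\<Omega> (p ai) (1 / real m) (snapshot (fst ai))" for ai
  define C where "C = (1 / real m)\<^sup>2 * (4 * (4 / 9) ^ n)"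
  have \<rho>: "hermitian_mat ?N \<rho>" using assms(3) by (simp add: density_matrix_def)
  then have c\<rho>: "\<rho> \<in> carrier_mat ?N ?N" by (simp add: hermitian_mat_def)
  have m0: "real m > 0" using assms(2) by simp
  have meas: "R a i \<in> measurable M (count_space ?\<Omega>)" if "a \<in> settings n" "i \<in> {1..m}" for a i
    using assms(6) that unfolding indep_vars_def by auto
  have p_sum: "(\<Sum>r\<in>?\<Omega>. p ai r) = 1" if "ai \<in> ?I" for ai
    unfolding p_def using that meas
    by (intro prob_finite_valued_sum[OF assms(5)]) (auto split: prod.split)
  have p_nonneg: "0 \<le> p ai r" for ai r by (simp add: p_def)
  interpret F: centered_matrix_family ?N ?I ?\<Omega> p X C
  proof
    show "hermitian_mat ?N (X ai x)" if "ai \<in> ?I" "x \<in> ?\<Omega>" for ai x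
      unfolding X_def using that by (intro hermitian_centered_mat hermitian_snapshot) auto
    show "op_norm_sq_le ?N (X ai x) C" if "ai \<in> ?I" "x \<in> ?\<Omega>" for ai x
      unfolding X_def C_def using that by (intro op_norm_centered_mat p_nonneg p_sum op_norm_snapshot) auto
    show "(\<Sum>x\<in>?\<Omega>. complex_of_real (p ai x) * X ai x $$ (k, l)) = 0" if "ai \<in> ?I" "k < ?N" "l < ?N" for ai k l
      unfolding X_def using that by (intro centered_mat_mean p_sum) auto
  qed (auto simp: p_nonneg p_sum C_def)
  let ?A = "\<lambda>d. lin_estimator n m (\<lambda>a i. d (a, i))"
  have error: "?A d - \<rho> = F.total ?I d" if d: "d \<in> ?I \<rightarrow>\<^sub>E ?\<Omega>" for d
  proof (rule eq_matI)
    fix k l assume "k < dim_row (F.total ?I d)" "l < dim_col (F.total ?I d)"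
    then have kl: "k < ?N" "l < ?N" by auto
    let ?mean = "\<lambda>a i. \<Sum>r\<in>?\<Omega>. complex_of_real (p (a, i) r) * snapshot a r $$ (k, l)"
    have "(\<Sum>a\<in>settings n. \<Sum>i = 1..m. ?mean a i)
        = (\<Sum>a\<in>settings n. \<Sum>i = 1..m. \<Sum>r\<in>?\<Omega>. mat_trace (\<rho> * outcome_proj a r) * snapshot a r $$ (k, l))"
      by (intro sum.cong refl) (simp add: p_def assms(7))
    also have "\<dots> = of_nat m * \<rho> $$ (k, l)"
      by (simp add: sum_distrib_left[symmetric] snapshot_unbiased[OF c\<rho> kl])
    finally have mean: "(\<Sum>a\<in>settings n. \<Sum>i = 1..m. ?mean a i) = of_nat m * \<rho> $$ (k, l)" .
    have "F.total ?I d $$ (k, l) = (\<Sum>a\<in>settings n. \<Sum>i = 1..m.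
        complex_of_real (1 / real m) * (snapshot a (d (a, i)) $$ (k, l) - ?mean a i))"
      using kl by (simp add: matrix_sum_def X_def centered_mat_def sum.cartesian_product split_beta)
    also have "\<dots> = complex_of_real (1 / real m) * (\<Sum>a\<in>settings n. \<Sum>i = 1..m. snapshot a (d (a, i)) $$ (k, l))
        - complex_of_real (1 / real m) * (\<Sum>a\<in>settings n. \<Sum>i = 1..m. ?mean a i)"
      by (simp only: sum_distrib_left[symmetric] sum_subtractf right_diff_distrib)
    also have "complex_of_real (1 / real m) * (\<Sum>a\<in>settings n. \<Sum>i = 1..m. ?mean a i) = \<rho> $$ (k, l)"
      unfolding mean using m0 by simp
    also have "complex_of_real (1 / real m) * (\<Sum>a\<in>settings n. \<Sum>i = 1..m. snapshot a (d (a, i)) $$ (k, l)) = ?A d $$ (k, l)"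
      using d kl by (intro lin_estimator_snapshot[symmetric]) (auto simp: PiE_iff)
    finally show "(?A d - \<rho>) $$ (k, l) = F.total ?I d $$ (k, l)" using kl c\<rho> by simp
  qed (use c\<rho> in auto)
  define L where "L = real n * ln 2 - ln \<epsilon>"
  define s where "s = nat \<lceil>L\<rceil>"
  \<comment> \<open>The number of data times \<open>C\<close> is \<open>4 (4/3)^n / m\<close>, and \<open>\<tau>\<close> is \<open>8 L\<close> times this;
    it is also the largest threshold that \<open>oracle_inequality\<close> admits for the given \<open>\<nu>\<close>.\<close>
  define \<tau> where "\<tau> = 32 * (4 / 3) ^ n * (L / real m)"
  have L0: "L > 0"
  proof -
    have "ln \<epsilon> < 0" "0 \<le> real n * ln 2" using assms(9,10) by simp_all
    then show ?thesis unfolding L_def by linarith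
  qed
  have \<tau>0: "0 < \<tau>" using L0 m0 by (simp add: \<tau>_def)
  have nu: "nu_choice n m \<theta> \<epsilon> = (1 + \<theta>) * \<tau>"
    unfolding nu_choice_def \<tau>_def L_def by (simp only: mult_ac)
  have size: "real s * (real (card ?I) * C) / \<tau> = real s / (8 * L)"
  proof -
    have "(3 :: real) ^ n * (4 / 9) ^ n = (4 / 3) ^ n" by (simp add: power_mult_distrib[symmetric])
    then have "real (card ?I) * C = 4 * (4 / 3) ^ n / real m"
      using m0 by (simp add: C_def card_cartesian_product card_settings power2_eq_square field_simps)
    then show ?thesis using m0 L0 by (simp add: \<tau>_def field_simps)
  qed
  have ev: "char_poly \<rho> = (\<Prod>e\<leftarrow>map (\<lambda>j. complex_of_real (lam j)) [1..<Suc ?N]. [:- e, 1:])"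
    using assms(4) unfolding ordered_eigenvalues_def
    by (simp add: o_def prod.distinct_set_conv_list[symmetric] atLeastLessThanSuc_atLeastAtMost del: upt_Suc)
  obtain U where "eigendecomp ?N U (\<lambda>i. Re (map (\<lambda>j. complex_of_real (lam j)) [1..<Suc ?N] ! i)) \<rho>"
    using hermitian_eigendecomp_of_roots[OF \<rho> ev] by auto
  moreover have "mat_diag ?N (\<lambda>i. complex_of_real (Re (map (\<lambda>j. complex_of_real (lam j)) [1..<Suc ?N] ! i)))
      = mat_diag ?N (\<lambda>i. complex_of_real (lam (Suc i)))"
    by (intro mat_diag_cong) (simp del: upt_Suc)
  ultimately have U: "eigendecomp ?N U (\<lambda>i. lam (Suc i)) \<rho>" by (simp add: eigendecomp_def)
  let ?goal = "\<lambda>A. \<forall>S. rank_penalized_minimizer ?N (nu_choice n m \<theta> \<epsilon>) A S \<longrightarrow>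
    frob_norm_sq (S - \<rho>) \<le> Min ((\<lambda>k. (oracle_const \<theta>)\<^sup>2 * (\<Sum>j\<in>{k<..?N}. (lam j)\<^sup>2)
      + 2 * oracle_const \<theta> * nu_choice n m \<theta> \<epsilon> * real k) ` {1..?N})"
  have good: "?goal (?A d)" if d: "d \<in> ?I \<rightarrow>\<^sub>E ?\<Omega>"
    and small: "Re (mat_trace (F.total ?I d ^\<^sub>m (2 * s))) < \<tau> ^ s" for d
  proof (intro allI impI Min.boundedI)
    fix S x
    assume S: "rank_penalized_minimizer ?N (nu_choice n m \<theta> \<epsilon>) (?A d) S"
      and "x \<in> (\<lambda>k. (oracle_const \<theta>)\<^sup>2 * (\<Sum>j\<in>{k<..?N}. (lam j)\<^sup>2)
        + 2 * oracle_const \<theta> * nu_choice n m \<theta> \<epsilon> * real k) ` {1..?N}"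
    then obtain k where k: "k \<le> ?N" and x: "x = (oracle_const \<theta>)\<^sup>2 * (\<Sum>j\<in>{k<..?N}. (lam j)\<^sup>2)
        + 2 * oracle_const \<theta> * nu_choice n m \<theta> \<epsilon> * real k" by auto
    have A: "hermitian_mat ?N (?A d)"
      by (rule hermitian_of_minus[OF _ \<rho>]) (use F.hermitian_total[OF subset_refl d] error[OF d] in \<open>auto simp: lin_estimator_def\<close>)
    have "frob_norm_sq (S - \<rho>) \<le> (oracle_const \<theta>)\<^sup>2 * (\<Sum>i\<in>{k..<?N}. (lam (Suc i))\<^sup>2)
        + 2 * oracle_const \<theta> * nu_choice n m \<theta> \<epsilon> * real k"
      by (rule oracle_inequality[OF \<rho> U A S _ \<tau>0 assms(8) _ k]) (use small error[OF d] nu in auto)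
    also have "(\<Sum>i\<in>{k..<?N}. (lam (Suc i))\<^sup>2) = (\<Sum>j\<in>{k<..?N}. (lam j)\<^sup>2)"
      by (rule sum.reindex_bij_witness[of _ "\<lambda>j. j - 1" Suc]) auto
    finally show "frob_norm_sq (S - \<rho>) \<le> x" unfolding x .
  qed auto
  let ?w = "\<lambda>d. \<Prod>ai\<in>?I. p ai (d ai)"
  let ?bad = "{d. d \<in> ?I \<rightarrow>\<^sub>E ?\<Omega> \<and> Re (mat_trace (F.total ?I d ^\<^sub>m (2 * s))) \<ge> \<tau> ^ s}"
  let ?good = "{d. d \<in> ?I \<rightarrow>\<^sub>E ?\<Omega> \<and> ?goal (?A d)}"
  have fin: "finite (?I \<rightarrow>\<^sub>E ?\<Omega>)" by (simp add: finite_PiE)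
  have "(\<Sum>d\<in>?bad. ?w d) \<le> real ?N * (real s * (real (card ?I) * C) / \<tau>) ^ s"
    by (rule F.tail_bound[OF \<tau>0])
  also have "\<dots> < \<epsilon>"
    unfolding size unfolding s_def using tail_constant_less[OF assms(1,9,10) L_def] by simp
  finally have bad: "(\<Sum>d\<in>?bad. ?w d) < \<epsilon>" .
  have "1 = (\<Sum>d\<in>?I \<rightarrow>\<^sub>E ?\<Omega>. ?w d)"
    using F.prod_expect_1[of ?I 1] by (simp add: prod_expect_def)
  also have "\<dots> = (\<Sum>d\<in>(?I \<rightarrow>\<^sub>E ?\<Omega>) - ?bad. ?w d) + (\<Sum>d\<in>?bad. ?w d)"
    by (rule sum.subset_diff[OF _ fin]) auto
  finally have total: "1 = (\<Sum>d\<in>(?I \<rightarrow>\<^sub>E ?\<Omega>) - ?bad. ?w d) + (\<Sum>d\<in>?bad. ?w d)" .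
  have "(\<Sum>d\<in>(?I \<rightarrow>\<^sub>E ?\<Omega>) - ?bad. ?w d) \<le> (\<Sum>d\<in>?good. ?w d)"
    using fin good by (intro sum_mono2) (auto simp: not_le intro!: prod_nonneg p_nonneg)
  with total bad have "1 - \<epsilon> < (\<Sum>d\<in>?good. ?w d)" by linarith
  also have "\<dots> = measure M {\<omega> \<in> space M. ?goal (?A (\<lambda>ai\<in>?I. (case ai of (a, i) \<Rightarrow> R a i) \<omega>))}"
  proof -
    have "replicate n PX \<in> settings n" by (auto simp: settings_def)
    then have "?I \<noteq> {}" using assms(2) by auto
    then show ?thesis
      using indep_vars_finite_law[OF assms(5,6), of "\<lambda>d. ?goal (?A d)"] by (simp add: p_def)
  qed
  also have "{\<omega> \<in> space M. ?goal (?A (\<lambda>ai\<in>?I. (case ai of (a, i) \<Rightarrow> R a i) \<omega>))}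
      = {\<omega> \<in> space M. ?goal (lin_estimator n m (\<lambda>a i. R a i \<omega>))}"
  proof -
    have "?A (\<lambda>ai\<in>?I. (case ai of (a, i) \<Rightarrow> R a i) \<omega>) = lin_estimator n m (\<lambda>a i. R a i \<omega>)" for \<omega>
      by (rule lin_estimator_cong) auto
    then show ?thesis by simp
  qed
  finally show ?thesis .
qed

end
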